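(* Let $k$ be a field, $d$ a positive integer, $G$ a graph on $[n]$, and $H$ an induced subgraph of $G$. Then for all $i,j\ge0$ and $s\ge1$, $$\beta_{i,j}(S/L_H(d)^s)\le\beta_{i,j}(S/L_G(d)^s).$$
   Context: Graphs are finite, simple and undirected, with vertex set $V(G)=[n]=\{1,\dots,n\}$ and edge set $E(G)$. For a field $k$ and $d\ge1$, $S=k[x_{ij}: i\in[n],\ j\in[d]]$ is a standard graded polynomial ring, and for a subgraph $H$ of $G$ (including $H=G$) the LSS-ideal $L_H(d)$ is the ideal generated by $f_e^{(d)}=\sum_{\ell=1}^d x_{i\ell}x_{j\ell}$, $e=\{i,j\}\in E(H)$. For a finitely generated graded $S$-module $M$, $\beta_{i,j}(M)=\dim_k\operatorname{Tor}_i^S(M,k)_j$ are the graded Betti numbers. *)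

theory Defs
  imports Complex_Main "HOL-Library.Poly_Mapping"
begin

section \<open>Polynomial rings and ideals\<close>

text \<open>The polynomial ring over \<open>'k\<close> in the variables indexed by the (finite) type \<open>'v\<close>.
  Monomials are exponent functions \<open>'v \<Rightarrow>\<^sub>0 nat\<close>.\<close>

type_synonym ('v, 'k) mpol = "('v \<Rightarrow>\<^sub>0 nat) \<Rightarrow>\<^sub>0 'k"

definition pvar :: "'v \<Rightarrow> ('v, 'k::comm_ring_1) mpol" where
  "pvar v = Poly_Mapping.single (Poly_Mapping.single v 1) 1"

definition mdeg :: "('v \<Rightarrow>\<^sub>0 nat) \<Rightarrow> nat" where
  "mdeg m = (\<Sum>v\<in>Poly_Mapping.keys m. Poly_Mapping.lookup m v)"

text \<open>The zero polynomial is homogeneous of every degree.\<close>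

definition homogeneous :: "nat \<Rightarrow> ('v, 'k::zero) mpol \<Rightarrow> bool" where
  "homogeneous e p \<longleftrightarrow> (\<forall>m\<in>Poly_Mapping.keys p. mdeg m = e)"

text \<open>The projection \<open>S \<rightarrow> S/\<mm> = k\<close> onto the constant term.\<close>

definition const_term :: "('v, 'k::zero) mpol \<Rightarrow> 'k" where
  "const_term p = Poly_Mapping.lookup p 0"

definition ideal_gen :: "'r::comm_ring_1 set \<Rightarrow> 'r set" where
  "ideal_gen A = module.span (*) A"

fun ideal_pow :: "'r::comm_ring_1 set \<Rightarrow> nat \<Rightarrow> 'r set" where
  "ideal_pow I 0 = UNIV"
| "ideal_pow I (Suc s) = ideal_gen {a * b | a b. a \<in> I \<and> b \<in> ideal_pow I s}"

lemma module_mult: "module ((*) :: 'r::comm_ring_1 \<Rightarrow> 'r \<Rightarrow> 'r)"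
  by unfold_locales (simp_all add: algebra_simps)

section \<open>Free modules with a chosen basis\<close>

text \<open>The free module on a set \<open>B\<close> of natural numbers is the set of all \<open>x :: nat \<Rightarrow>\<^sub>0 'r\<close> with
  \<open>keys x \<subseteq> B\<close>; a linear map out of it is given by the images of the basis elements.\<close>

definition free_on :: "nat set \<Rightarrow> (nat \<Rightarrow>\<^sub>0 'r::zero) set" where
  "free_on B = {x. Poly_Mapping.keys x \<subseteq> B}"

definition fscale :: "'r::comm_ring_1 \<Rightarrow> (nat \<Rightarrow>\<^sub>0 'r) \<Rightarrow> (nat \<Rightarrow>\<^sub>0 'r)" where
  "fscale c x = Poly_Mapping.map ((*) c) x"

definition lin_ext :: "('r \<Rightarrow> 'm \<Rightarrow> 'm) \<Rightarrow> (nat \<Rightarrow> 'm) \<Rightarrow> (nat \<Rightarrow>\<^sub>0 'r::zero) \<Rightarrow> 'm::comm_monoid_add" where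
  "lin_ext scale f x = (\<Sum>b\<in>Poly_Mapping.keys x. scale (Poly_Mapping.lookup x b) (f b))"

lemma lookup_fscale: "Poly_Mapping.lookup (fscale c x) b = c * Poly_Mapping.lookup x b"
  by (simp add: fscale_def Poly_Mapping.map.rep_eq when_def)

lemma vector_space_fscale: "vector_space (fscale :: 'k::field \<Rightarrow> _)"
  by unfold_locales
    (auto intro!: poly_mapping_eqI simp: lookup_fscale lookup_add algebra_simps)

section \<open>Graded free resolutions and graded Betti numbers of \<open>S/I\<close>\<close>

text \<open>Data of an augmented complex \<open>\<dots> \<rightarrow> F\<^sub>1 \<rightarrow> F\<^sub>0 \<rightarrow> S/I\<close> of graded free \<open>S\<close>-modules:
  \<open>F\<^sub>i\<close> is free on \<open>basis F i\<close>, where \<open>b \<in> basis F i\<close> has degree \<open>bdeg F i b\<close>; \<open>bdry F i b\<close> is the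
  image in \<open>F\<^sub>i\<close> of the basis element \<open>b\<close> of \<open>F\<^sub>i\<^sub>+\<^sub>1\<close> (note the shift), and \<open>augm F b\<close> is a
  polynomial representing the class in \<open>S/I\<close> to which the basis element \<open>b\<close> of \<open>F\<^sub>0\<close> is mapped.\<close>

record (overloaded) ('v, 'k) free_cplx =
  basis :: "nat \<Rightarrow> nat set"
  bdeg :: "nat \<Rightarrow> nat \<Rightarrow> nat"
  bdry :: "nat \<Rightarrow> nat \<Rightarrow> (nat \<Rightarrow>\<^sub>0 ('v, 'k) mpol)"
  augm :: "nat \<Rightarrow> ('v, 'k) mpol"

definition bdry_map ::
  "('v, 'k::field) free_cplx \<Rightarrow> nat \<Rightarrow> (nat \<Rightarrow>\<^sub>0 ('v, 'k) mpol) \<Rightarrow> (nat \<Rightarrow>\<^sub>0 ('v, 'k) mpol)" where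
  "bdry_map F i = lin_ext fscale (bdry F i)"

definition augm_map ::
  "('v, 'k::field) free_cplx \<Rightarrow> (nat \<Rightarrow>\<^sub>0 ('v, 'k) mpol) \<Rightarrow> ('v, 'k) mpol" where
  "augm_map F = lin_ext (*) (augm F)"

text \<open>The \<open>F\<^sub>i\<close> need not have finite rank, but only finitely many basis elements of each degree,
  i.e. each graded component of \<open>F\<^sub>i\<close> is finite-dimensional over \<open>k\<close>. Every finitely generated
  graded free resolution is of this kind, and Tor may be computed from any of these resolutions.\<close>

definition graded_free_resolution ::
  "('v, 'k::field) mpol set \<Rightarrow> ('v, 'k) free_cplx \<Rightarrow> bool" where
  "graded_free_resolution I F \<longleftrightarrow>
     (\<forall>i j. finite {b \<in> basis F i. bdeg F i b = j}) \<and>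
     \<comment> \<open>the maps are well defined and homogeneous of degree 0\<close>
     (\<forall>b\<in>basis F 0. homogeneous (bdeg F 0 b) (augm F b)) \<and>
     (\<forall>i. \<forall>b\<in>basis F (Suc i). bdry F i b \<in> free_on (basis F i) \<and>
        (\<forall>c\<in>basis F i. \<forall>m\<in>Poly_Mapping.keys (Poly_Mapping.lookup (bdry F i b) c).
           mdeg m + bdeg F i c = bdeg F (Suc i) b)) \<and>
     \<comment> \<open>exactness at \<open>S/I\<close>, at \<open>F\<^sub>0\<close>, and at \<open>F\<^sub>i\<^sub>+\<^sub>1\<close>\<close>
     (\<forall>p. \<exists>x\<in>free_on (basis F 0). augm_map F x - p \<in> I) \<and>
     {x \<in> free_on (basis F 0). augm_map F x \<in> I} = bdry_map F 0 ` free_on (basis F 1) \<and>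
     (\<forall>i. {x \<in> free_on (basis F (Suc i)). bdry_map F i x = 0}
        = bdry_map F (Suc i) ` free_on (basis F (Suc (Suc i))))"

text \<open>The complex \<open>F \<otimes>\<^sub>S k\<close>: as \<open>S\<^sup>(\<^sup>B\<^sup>) \<otimes>\<^sub>S k = k\<^sup>(\<^sup>B\<^sup>)\<close>, it consists of the \<open>k\<close>-vector spaces on the
  same bases, and its differentials are obtained by applying \<open>S \<rightarrow> k\<close> to the matrix entries.
  Its component of internal degree \<open>j\<close> is spanned by the basis elements of degree \<open>j\<close>.\<close>

definition tensor_comp :: "('v, 'k::field) free_cplx \<Rightarrow> nat \<Rightarrow> nat \<Rightarrow> (nat \<Rightarrow>\<^sub>0 'k) set" where
  "tensor_comp F i j = free_on {b \<in> basis F i. bdeg F i b = j}"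

definition tensor_map :: "('v, 'k::field) free_cplx \<Rightarrow> nat \<Rightarrow> (nat \<Rightarrow>\<^sub>0 'k) \<Rightarrow> (nat \<Rightarrow>\<^sub>0 'k)" where
  "tensor_map F i = lin_ext fscale (\<lambda>b. Poly_Mapping.map const_term (bdry F i b))"

definition tor_cycles :: "('v, 'k::field) free_cplx \<Rightarrow> nat \<Rightarrow> nat \<Rightarrow> (nat \<Rightarrow>\<^sub>0 'k) set" where
  "tor_cycles F i j =
     (case i of 0 \<Rightarrow> tensor_comp F 0 j
      | Suc i' \<Rightarrow> {x \<in> tensor_comp F i j. tensor_map F i' x = 0})"

definition tor_boundaries :: "('v, 'k::field) free_cplx \<Rightarrow> nat \<Rightarrow> nat \<Rightarrow> (nat \<Rightarrow>\<^sub>0 'k) set" where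
  "tor_boundaries F i j = tensor_map F i ` tensor_comp F (Suc i) j"

text \<open>The dimension of \<open>H\<^sub>i(F \<otimes>\<^sub>S k)\<^sub>j\<close>, the quotient of the cycles by the boundaries. For a graded
  free resolution \<open>F\<close> the space of cycles is finite-dimensional and contains the boundaries, so the
  dimension of the quotient is this difference.\<close>

definition tor_dim :: "('v, 'k::field) free_cplx \<Rightarrow> nat \<Rightarrow> nat \<Rightarrow> nat" where
  "tor_dim F i j =
     vector_space.dim fscale (tor_cycles F i j) - vector_space.dim fscale (tor_boundaries F i j)"

text \<open>\<open>\<beta>\<^sub>i\<^sub>,\<^sub>j(S/I) = dim\<^sub>k Tor\<^sub>i(S/I, k)\<^sub>j\<close> for a homogeneous ideal \<open>I\<close>, computed from a graded free
  resolution of \<open>S/I\<close>; the value does not depend on which one is chosen.\<close>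

definition betti_quot :: "('v, 'k::field) mpol set \<Rightarrow> nat \<Rightarrow> nat \<Rightarrow> nat" where
  "betti_quot I i j = tor_dim (SOME F. graded_free_resolution I F) i j"

section \<open>Graphs and LSS-ideals\<close>

record 'a ugraph =
  vertices :: "'a set"
  edges :: "'a set set"

definition simple_graph :: "'a ugraph \<Rightarrow> bool" where
  "simple_graph G \<longleftrightarrow> finite (vertices G) \<and> (\<forall>e\<in>edges G. e \<subseteq> vertices G \<and> card e = 2)"

definition induced_subgraph :: "'a ugraph \<Rightarrow> 'a ugraph \<Rightarrow> bool" where
  "induced_subgraph H G \<longleftrightarrow>
     vertices H \<subseteq> vertices G \<and> edges H = {e \<in> edges G. e \<subseteq> vertices H}"

text \<open>The index types \<open>'n\<close> and \<open>'d\<close> play the roles of \<open>[n]\<close> and \<open>[d]\<close>, so that the ring \<open>S\<close> is the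
  type \<open>('n \<times> 'd, 'k) mpol\<close>. The ideal lives in the same ring \<open>S\<close> for all graphs on vertices in
  \<open>'n\<close>, also for those not containing every vertex.\<close>

definition lss_ideal :: "'n ugraph \<Rightarrow> ('n \<times> 'd::finite, 'k::field) mpol set" where
  "lss_ideal H = ideal_gen {(\<Sum>l\<in>UNIV. pvar (i, l) * pvar (j, l)) | i j. {i, j} \<in> edges H}"

end

theory Submission
  imports Defs "HOL-Library.FuncSet" "HOL-Library.Countable_Set"
begin

text \<open>
  Let \<open>W\<close> be the set of variables \<open>x\<^sub>i\<^sub>l\<close> with \<open>i\<close> a vertex of \<open>H\<close>, let \<open>\<phi>\<close> be the ring endomorphism of
  \<open>S\<close> that sets all other variables to zero, and put \<open>I = L\<^sub>H(d)\<^sup>s\<close> and \<open>J = L\<^sub>G(d)\<^sup>s\<close>. Since \<open>H\<close> is a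
  subgraph, \<open>I \<subseteq> J\<close>. Since it is induced, \<open>\<phi>\<close> fixes the generator of an edge of \<open>G\<close> with both ends in
  \<open>H\<close>, which is an edge of \<open>H\<close>, and kills every other one; hence \<open>\<phi>(J) \<subseteq> I\<close>. So the projection
  \<open>S/I \<rightarrow> S/J\<close> followed by the \<open>\<phi>\<close>-semilinear map \<open>S/J \<rightarrow> S/I\<close> is the map that \<open>\<phi>\<close> induces on \<open>S/I\<close>, and
  the theorem follows once this map is known to act bijectively on Tor.

  For that, \<open>S/I\<close> is resolved by a complex \<open>K\<close> all of whose matrix entries are fixed by \<open>\<phi>\<close>
  (\<open>resolution_exists\<close>). It is built degree by degree: the kernel of a matrix with entries in \<open>k[W]\<close> is
  generated by vectors over \<open>k[W]\<close>, as \<open>S\<close> is free over \<open>k[W]\<close> on the monomials in the remaining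
  variables (\<open>kernel_hom_generated\<close>), and choosing a \<open>k\<close>-basis of the homogeneous generators in each
  degree keeps every graded component finite-dimensional without any appeal to noetherianity.

  Applying \<open>\<phi>\<close> to coordinates is then a \<open>\<phi>\<close>-semilinear chain map \<open>K \<rightarrow> K\<close> over \<open>\<phi>\<close> on \<open>S/I\<close>, and it
  becomes the identity on \<open>K \<otimes> k\<close> because \<open>\<phi>\<close> preserves constant terms. For any resolution \<open>G\<close> of \<open>S/J\<close>
  there are comparison maps \<open>K \<rightarrow> G\<close>, linear, and \<open>G \<rightarrow> K\<close>, \<open>\<phi>\<close>-semilinear (\<open>comparison_map\<close>). Their
  composite lifts the same map of \<open>S/I\<close>, so it is homotopic to the coordinatewise action of \<open>\<phi>\<close>
  (\<open>null_homotopy\<close>) and thus is the identity on the homology of \<open>K \<otimes> k\<close>. Therefore \<open>G \<rightarrow> K\<close> is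
  surjective on Tor, in each internal degree (\<open>tor_dim_retract\<close>). With \<open>\<phi>\<close> the identity and \<open>I = J\<close> the
  same statement compares two resolutions of \<open>S/I\<close>, so the value does not depend on the resolution.
\<close>

abbreviation keys where "keys \<equiv> Poly_Mapping.keys"
abbreviation lookup where "lookup \<equiv> Poly_Mapping.lookup"
abbreviation single where "single \<equiv> Poly_Mapping.single"

section \<open>Selecting monomials\<close>

definition pfilter :: "('a \<Rightarrow> bool) \<Rightarrow> ('a \<Rightarrow>\<^sub>0 'b::zero) \<Rightarrow> ('a \<Rightarrow>\<^sub>0 'b)" where
  "pfilter P p = Poly_Mapping.mapp (\<lambda>m c. if P m then c else 0) p"

lemma lookup_pfilter:
  "lookup (pfilter P p) m = (if P m then lookup p m else 0)"
  by (simp add: pfilter_def lookup_mapp when_def in_keys_iff)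

lemma keys_pfilter: "keys (pfilter P p) = {m \<in> keys p. P m}"
  by (auto simp: in_keys_iff lookup_pfilter split: if_splits)

lemma pfilter_add: "pfilter P (p + q) = pfilter P p + pfilter P (q :: 'a \<Rightarrow>\<^sub>0 'b::monoid_add)"
  by (rule poly_mapping_eqI) (simp add: lookup_pfilter lookup_add)

lemma pfilter_zero [simp]: "pfilter P 0 = 0"
  by (rule poly_mapping_eqI) (simp add: lookup_pfilter)

lemma pfilter_id: "(\<And>m. m \<in> keys p \<Longrightarrow> P m) \<Longrightarrow> pfilter P p = p"
  by (rule poly_mapping_eqI) (auto simp: lookup_pfilter in_keys_iff)

lemma pfilter_none: "(\<And>m. m \<in> keys p \<Longrightarrow> \<not> P m) \<Longrightarrow> pfilter P p = 0"
  by (rule poly_mapping_eqI) (auto simp: lookup_pfilter in_keys_iff)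

text \<open>Splitting \<open>p\<close> into its \<open>Q\<close>-part and the rest, every monomial of the first product satisfies \<open>P\<close>
  and none of the second does. All grading arguments below reduce to this: selecting a total degree
  and selecting the exponents of some of the variables are both of this form.\<close>

lemma pfilter_mult:
  fixes p q :: "'a::comm_monoid_add \<Rightarrow>\<^sub>0 'b::comm_ring_1"
  assumes shift: "\<And>a m. m \<in> keys q \<Longrightarrow> P (a + m) \<longleftrightarrow> Q a"
  shows "pfilter P (p * q) = pfilter Q p * q"
proof -
  have split: "p = pfilter Q p + pfilter (\<lambda>a. \<not> Q a) p"
    by (rule poly_mapping_eqI) (simp add: lookup_pfilter lookup_add)
  have "pfilter P (pfilter Q p * q) = pfilter Q p * q"
    by (rule pfilter_id) (use shift keys_mult[of "pfilter Q p" q] in \<open>auto simp: keys_pfilter\<close>)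
  moreover have "pfilter P (pfilter (\<lambda>a. \<not> Q a) p * q) = 0"
    by (rule pfilter_none)
      (use shift keys_mult[of "pfilter (\<lambda>a. \<not> Q a) p" q] in \<open>auto simp: keys_pfilter\<close>)
  ultimately show ?thesis
    by (subst split) (simp add: distrib_right pfilter_add)
qed

lemma lookup_monomial_mult:
  fixes q :: "'a::cancel_comm_monoid_add \<Rightarrow>\<^sub>0 'b::comm_ring_1"
  shows "lookup (single c 1 * q) k
       = (\<Sum>m\<in>keys q. if c + m = k then lookup q m else 0)"
proof -
  let ?s = "\<Sum>m\<in>keys q. single m (lookup q m)"
  have "?s = q"
    by (rule poly_mapping_eqI) (simp add: lookup_sum lookup_single when_def in_keys_iff)
  then have "single c 1 * q = single c 1 * ?s"
    by simp
  also have "\<dots> = (\<Sum>m\<in>keys q. single (c + m) (lookup q m))"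
    by (simp add: sum_distrib_left mult_single)
  finally show ?thesis
    by (simp add: lookup_sum lookup_single when_def)
qed

lemma lookup_monomial_mult_add:
  fixes q :: "'a::cancel_comm_monoid_add \<Rightarrow>\<^sub>0 'b::comm_ring_1"
  shows "lookup (single c 1 * q) (c + m) = lookup q m"
  by (simp add: lookup_monomial_mult in_keys_iff)

lemma monomial_mult_cancel:
  fixes p q :: "'a::cancel_comm_monoid_add \<Rightarrow>\<^sub>0 'b::comm_ring_1"
  assumes "single c 1 * p = single c 1 * q"
  shows "p = q"
  by (rule poly_mapping_eqI) (metis assms lookup_monomial_mult_add)

lemma keys_add_nat:
  "keys (a + b :: 'v \<Rightarrow>\<^sub>0 nat) = keys a \<union> keys b"
  by (auto simp: in_keys_iff lookup_add)

lemma mdeg_superset: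
  assumes "finite A" "keys m \<subseteq> A"
  shows "mdeg m = (\<Sum>v\<in>A. lookup m v)"
  unfolding mdeg_def by (rule sum.mono_neutral_left) (use assms in \<open>auto simp: in_keys_iff\<close>)

lemma mdeg_add: "mdeg (a + b) = mdeg a + mdeg b"
  by (simp add: mdeg_superset[of "keys a \<union> keys b"]
      keys_add_nat lookup_add sum.distrib)

lemma lookup_le_mdeg: "lookup m v \<le> mdeg (m :: 'v::finite \<Rightarrow>\<^sub>0 nat)"
  unfolding mdeg_superset[OF finite_UNIV subset_UNIV] by (rule member_le_sum) auto

lemma mdeg_zero [simp]: "mdeg 0 = 0"
  by (simp add: mdeg_def)

lemma finite_monomials_of_degree: "finite {m :: 'v::finite \<Rightarrow>\<^sub>0 nat. mdeg m = e}"
proof (rule inj_on_finite)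
  show "inj_on lookup {m :: 'v \<Rightarrow>\<^sub>0 nat. mdeg m = e}"
    by (rule inj_onI) (rule poly_mapping_eqI, simp)
  show "lookup ` {m :: 'v \<Rightarrow>\<^sub>0 nat. mdeg m = e} \<subseteq> PiE UNIV (\<lambda>_. {..e})"
    using lookup_le_mdeg by (fastforce simp: PiE_iff)
  show "finite (PiE (UNIV :: 'v set) (\<lambda>_. {..e}))"
    by (rule finite_PiE) auto
qed

section \<open>Setting variables to zero\<close>

definition kill_vars :: "'v set \<Rightarrow> ('v, 'k::comm_ring_1) mpol \<Rightarrow> ('v, 'k) mpol" where
  "kill_vars W = pfilter (\<lambda>m. keys m \<subseteq> W)"

lemma kill_vars_add: "kill_vars W (p + q) = kill_vars W p + kill_vars W q"
  by (simp add: kill_vars_def pfilter_add)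

lemma kill_vars_zero [simp]: "kill_vars W 0 = 0"
  by (simp add: kill_vars_def)

lemma kill_vars_UNIV [simp]: "kill_vars UNIV p = p"
  by (simp add: kill_vars_def pfilter_id)

lemma kill_vars_kill_vars: "kill_vars W (kill_vars V p) = kill_vars (W \<inter> V) p"
  by (rule poly_mapping_eqI) (simp add: kill_vars_def lookup_pfilter)

lemma kill_vars_mult: "kill_vars W (p * q) = kill_vars W p * kill_vars W q"
proof -
  let ?r = "pfilter (\<lambda>m. \<not> keys m \<subseteq> W) q"
  have split: "q = kill_vars W q + ?r"
    by (rule poly_mapping_eqI) (simp add: kill_vars_def lookup_pfilter lookup_add)
  have "kill_vars W (p * kill_vars W q) = kill_vars W p * kill_vars W q"
    unfolding kill_vars_def by (rule pfilter_mult) (auto simp: keys_pfilter keys_add_nat)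
  moreover have "kill_vars W (p * ?r) = pfilter (\<lambda>_. False) p * ?r"
    unfolding kill_vars_def by (rule pfilter_mult) (auto simp: keys_pfilter keys_add_nat)
  moreover have "pfilter (\<lambda>_. False) p = 0"
    by (rule pfilter_none) auto
  ultimately show ?thesis
    by (subst split) (simp add: distrib_left kill_vars_add)
qed

lemma kill_vars_one [simp]: "kill_vars W 1 = 1"
  unfolding kill_vars_def by (rule pfilter_id) simp

lemma kill_vars_diff: "kill_vars W (p - q) = kill_vars W p - kill_vars W q"
  by (metis add_diff_cancel diff_add_cancel kill_vars_add)

lemma kill_vars_sum: "kill_vars W (sum f A) = (\<Sum>a\<in>A. kill_vars W (f a))"
  by (induction A rule: infinite_finite_induct) (auto simp: kill_vars_add)

lemma kill_vars_pvar: "kill_vars W (pvar v) = (if v \<in> W then pvar v else 0)"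
  by (auto simp: kill_vars_def pvar_def intro: pfilter_id pfilter_none)

lemma const_term_kill_vars: "const_term (kill_vars W p) = const_term p"
  by (simp add: const_term_def kill_vars_def lookup_pfilter)

text \<open>The constant term is what remains after killing every variable.\<close>

lemma const_term_mult: "const_term (p * q :: ('v, 'k::comm_ring_1) mpol) = const_term p * const_term q"
proof -
  have single: "pfilter (\<lambda>m. m = 0) r = single 0 (const_term r)" for r :: "('v, 'k) mpol"
    by (rule poly_mapping_eqI) (auto simp: lookup_pfilter const_term_def lookup_single when_def)
  have kill: "kill_vars {} r = pfilter (\<lambda>m. m = 0) r" for r :: "('v, 'k) mpol"
    by (simp add: kill_vars_def)
  have "single 0 (const_term (p * q))
      = single (0 :: 'v \<Rightarrow>\<^sub>0 nat) (const_term p * const_term q)"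
    using kill_vars_mult[of "{}" p q] by (simp add: kill single mult_single)
  then show ?thesis
    by (metis lookup_single_eq)
qed

section \<open>The coefficient of a monomial in the killed variables\<close>

text \<open>For \<open>c\<close> a monomial in the variables outside \<open>W\<close>, this is the coordinate of \<open>p\<close> at \<open>c\<close> when \<open>S\<close> is
  seen as the free module over \<open>k[W]\<close> on such monomials.\<close>

definition outside_coeff :: "'v set \<Rightarrow> ('v \<Rightarrow>\<^sub>0 nat) \<Rightarrow> ('v, 'k::comm_ring_1) mpol \<Rightarrow> ('v, 'k) mpol" where
  "outside_coeff W c p = kill_vars W (Poly_Mapping.map_key (\<lambda>m. c + m) p)"

lemma lookup_outside_coeff:
  "lookup (outside_coeff W c p) m
     = (if keys m \<subseteq> W then lookup p (c + m) else 0)"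
  by (simp add: outside_coeff_def kill_vars_def lookup_pfilter map_key.rep_eq inj_on_def)

lemma outside_coeff_add: "outside_coeff W c (p + q) = outside_coeff W c p + outside_coeff W c q"
  by (rule poly_mapping_eqI) (simp add: lookup_outside_coeff lookup_add)

lemma outside_coeff_zero [simp]: "outside_coeff W c 0 = 0"
  by (rule poly_mapping_eqI) (simp add: lookup_outside_coeff)

lemma kill_vars_outside_coeff [simp]: "kill_vars W (outside_coeff W c p) = outside_coeff W c p"
  by (simp add: outside_coeff_def kill_vars_kill_vars)

lemma pfilter_split: "(m :: 'a \<Rightarrow>\<^sub>0 'b::monoid_add) = pfilter (\<lambda>v. \<not> P v) m + pfilter P m"
  by (rule poly_mapping_eqI) (simp add: lookup_pfilter lookup_add)

lemma monomial_times_outside_coeff: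
  assumes c: "keys c \<inter> W = {}"
  shows "single c 1 * outside_coeff W c p = pfilter (\<lambda>m. pfilter (\<lambda>v. v \<notin> W) m = c) p"
proof (rule poly_mapping_eqI)
  fix k
  have outside: "pfilter (\<lambda>v. v \<notin> W) (c + m) = c" if "keys m \<subseteq> W" for m
    using that c by (subst pfilter_add) (simp add: pfilter_id pfilter_none disjoint_iff subset_iff)
  show "lookup (single c 1 * outside_coeff W c p) k
      = lookup (pfilter (\<lambda>m. pfilter (\<lambda>v. v \<notin> W) m = c) p) k"
  proof (cases "pfilter (\<lambda>v. v \<notin> W) k = c")
    case True
    have split: "k = c + pfilter (\<lambda>v. v \<in> W) k"
      using pfilter_split[of k "\<lambda>v. v \<in> W"] True by simp
    have "lookup (single c 1 * outside_coeff W c p) k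
        = lookup (outside_coeff W c p) (pfilter (\<lambda>v. v \<in> W) k)"
      by (subst split) (rule lookup_monomial_mult_add)
    also have "\<dots> = lookup p k"
      using split by (auto simp: lookup_outside_coeff keys_pfilter)
    finally show ?thesis using True by (simp add: lookup_pfilter)
  next
    case False
    then have "lookup (single c 1 * outside_coeff W c p) k = 0"
      using outside
      by (auto simp: lookup_monomial_mult lookup_outside_coeff intro!: sum.neutral)
    then show ?thesis using False by (simp add: lookup_pfilter)
  qed
qed

text \<open>Coordinates are \<open>k[W]\<close>-linear. Multiplied by \<open>c\<close>, they become the selection of those monomials
  whose part outside \<open>W\<close> is \<open>c\<close>, to which \<open>pfilter_mult\<close> applies; a monomial may be cancelled.\<close>

lemma outside_coeff_mult:
  assumes c: "keys c \<inter> W = {}" and q: "kill_vars W q = q"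
  shows "outside_coeff W c (p * q) = outside_coeff W c p * q"
proof (rule monomial_mult_cancel)
  have keys: "keys m \<subseteq> W" if "m \<in> keys q" for m
    using that q by (metis (no_types, lifting) kill_vars_def keys_pfilter mem_Collect_eq)
  have "single c 1 * outside_coeff W c (p * q)
      = pfilter (\<lambda>m. pfilter (\<lambda>v. v \<notin> W) m = c) p * q"
    unfolding monomial_times_outside_coeff[OF c]
  proof (rule pfilter_mult)
    fix a m assume "m \<in> keys q"
    then have "pfilter (\<lambda>v. v \<notin> W) m = 0"
      using keys by (intro pfilter_none) auto
    then show "pfilter (\<lambda>v. v \<notin> W) (a + m) = c \<longleftrightarrow> pfilter (\<lambda>v. v \<notin> W) a = c"
      by (simp add: pfilter_add)
  qed
  also have "\<dots> = single c 1 * (outside_coeff W c p * q)"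
    by (simp add: monomial_times_outside_coeff[OF c, symmetric] mult.assoc)
  finally show "single c 1 * outside_coeff W c (p * q)
      = single c 1 * (outside_coeff W c p * q)" .
qed

section \<open>Semilinear maps between free modules\<close>

interpretation free: module "fscale :: 'r::comm_ring_1 \<Rightarrow> (nat \<Rightarrow>\<^sub>0 'r) \<Rightarrow> _"
  by unfold_locales
    (auto intro!: poly_mapping_eqI simp: lookup_fscale lookup_add algebra_simps)

interpretation ideal: module "(*) :: 'r::comm_ring_1 \<Rightarrow> 'r \<Rightarrow> 'r"
  by (rule module_mult)

lemma lin_ext_superset:
  assumes "finite A" "keys x \<subseteq> A" "\<And>m. sc 0 m = 0"
  shows "lin_ext sc f x = (\<Sum>b\<in>A. sc (lookup x b) (f b))"
  unfolding lin_ext_def by (rule sum.mono_neutral_left) (use assms in \<open>auto simp: in_keys_iff\<close>)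

text \<open>The general form of the statement that an additive map is determined on a basis. The scalars may
  change along the way, from \<open>x\<close> to \<open>y\<close> and from \<open>sc\<close> to \<open>sc'\<close>; this covers semilinear maps, coordinates
  over \<open>k[W]\<close>, homogeneous parts and the reduction to \<open>k\<close>.\<close>

lemma lin_ext_natural:
  assumes "g 0 = 0" "\<And>m n. g (m + n) = g m + g n"
    and "keys y \<subseteq> keys x" "\<And>m. sc' 0 m = 0"
    and "\<And>b. b \<in> keys x \<Longrightarrow> g (sc (lookup x b) (f b)) = sc' (lookup y b) (f' b)"
  shows "g (lin_ext sc f x) = lin_ext sc' f' y"
proof -
  have "g (lin_ext sc f x) = (\<Sum>b\<in>keys x. g (sc (lookup x b) (f b)))"
    unfolding lin_ext_def using sum_comp_morphism[of g] assms(1,2) by (metis (no_types, lifting) comp_apply sum.cong)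
  also have "\<dots> = lin_ext sc' f' y"
    by (subst lin_ext_superset[of "keys x"]) (use assms in auto)
  finally show ?thesis .
qed

lemma lin_ext_add:
  assumes "\<And>a b m. sc (a + b) m = sc a m + sc b m" "\<And>m. sc 0 m = 0"
  shows "lin_ext sc f (x + y) = lin_ext sc f x + lin_ext sc f y"
  using keys_add[of x y]
  by (simp add: lin_ext_superset[of "keys x \<union> keys y"] assms lookup_add sum.distrib)

lemma lin_ext_single: "(\<And>m. sc 0 m = 0) \<Longrightarrow> lin_ext sc f (single b a) = sc a (f b)"
  by (subst lin_ext_superset[of "{b}"]) auto

lemma lin_ext_zero [simp]: "lin_ext sc f 0 = 0"
  by (simp add: lin_ext_def)

lemma lin_ext_cong: "(\<And>b. b \<in> keys x \<Longrightarrow> f b = g b) \<Longrightarrow> lin_ext sc f x = lin_ext sc g x"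
  by (simp add: lin_ext_def)

lemma lin_ext_images_diff:
  fixes f :: "nat \<Rightarrow> 'm::ab_group_add"
  assumes "\<And>a m n. sc a (m - n) = sc a m - sc a n"
  shows "lin_ext sc (\<lambda>b. f b - g b) x = lin_ext sc f x - lin_ext sc g x"
  by (simp add: lin_ext_def assms sum_subtractf)

lemma lin_ext_fscale_single: "lin_ext fscale (\<lambda>b. single b 1) x = x"
proof (rule poly_mapping_eqI)
  fix b
  have "lookup (lin_ext fscale (\<lambda>b. single b 1) x) b
      = (\<Sum>c\<in>keys x. lookup x c * (if c = b then 1 else 0))"
    by (simp add: lin_ext_def lookup_sum lookup_fscale lookup_single when_def)
  also have "\<dots> = (\<Sum>c\<in>keys x. if c = b then lookup x b else 0)"
    by (rule sum.cong) auto
  finally show "lookup (lin_ext fscale (\<lambda>b. single b 1) x) b = lookup x b"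
    by (simp add: in_keys_iff)
qed

lemma lin_ext_fscale_mem:
  assumes "free.subspace N" "\<And>b. b \<in> keys x \<Longrightarrow> f b \<in> N"
  shows "lin_ext (\<lambda>c. fscale (h c)) f x \<in> N"
  unfolding lin_ext_def using assms by (intro free.subspace_sum free.subspace_scale)

lemma lookup_map_zero: "h 0 = 0 \<Longrightarrow> lookup (Poly_Mapping.map h x) b = h (lookup x b)"
  by (simp add: Poly_Mapping.map.rep_eq when_def)

lemma map_zero [simp]: "Poly_Mapping.map h 0 = 0"
  by (simp add: map_eq_zero_iff)

lemma keys_map_subset: "keys (Poly_Mapping.map h x) \<subseteq> keys x"
  by (auto simp: in_keys_iff Poly_Mapping.map.rep_eq when_def split: if_splits)

lemma subspace_free_on: "free.subspace (free_on B)"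
proof (rule free.subspaceI)
  fix x y :: "nat \<Rightarrow>\<^sub>0 'a" and c assume "x \<in> free_on B" "y \<in> free_on B"
  then show "x + y \<in> free_on B"
    using keys_add[of x y] by (auto simp: free_on_def)
next
  fix x :: "nat \<Rightarrow>\<^sub>0 'a" and c assume "x \<in> free_on B"
  moreover have "keys (fscale c x) \<subseteq> keys x"
    unfolding fscale_def by (rule keys_map_subset)
  ultimately show "fscale c x \<in> free_on B"
    by (auto simp: free_on_def)
qed (simp add: free_on_def)

lemma single_free_on: "b \<in> B \<Longrightarrow> single b a \<in> free_on B"
  by (simp add: free_on_def)

text \<open>The map that is semilinear over \<open>kill_vars W\<close> with prescribed images of the basis; for \<open>W = UNIV\<close> it
  is the linear one. Linear and semilinear maps form one family, which is closed under composition.\<close>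

definition slin ::
  "'v set \<Rightarrow> (nat \<Rightarrow> (nat \<Rightarrow>\<^sub>0 ('v, 'k) mpol)) \<Rightarrow> (nat \<Rightarrow>\<^sub>0 ('v, 'k::comm_ring_1) mpol)
    \<Rightarrow> (nat \<Rightarrow>\<^sub>0 ('v, 'k) mpol)" where
  "slin W f = lin_ext (\<lambda>c. fscale (kill_vars W c)) f"

lemma slin_UNIV: "slin UNIV f = lin_ext fscale f"
  by (simp add: slin_def)

lemma slin_add: "slin W f (x + y) = slin W f x + slin W f y"
  unfolding slin_def by (rule lin_ext_add) (simp_all add: kill_vars_add free.scale_left_distrib)

lemma slin_zero [simp]: "slin W f 0 = 0"
  by (simp add: slin_def)

lemma slin_diff: "slin W f (x - y) = slin W f x - slin W f y"
  by (metis add_diff_cancel diff_add_cancel slin_add)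

lemma slin_scale: "slin W f (fscale c x) = fscale (kill_vars W c) (slin W f x)"
proof -
  have "fscale (kill_vars W c) (slin W f x)
      = lin_ext (\<lambda>a. fscale (kill_vars W c * kill_vars W a)) f x"
    unfolding slin_def by (rule lin_ext_natural) (auto simp: free.scale_right_distrib)
  also have "\<dots> = slin W f (fscale c x)"
    unfolding slin_def
    by (subst lin_ext_superset[of "keys x" "fscale c x"])
      (auto simp: lin_ext_def in_keys_iff lookup_fscale kill_vars_mult)
  finally show ?thesis by simp
qed

lemma slin_single: "slin W f (single b a) = fscale (kill_vars W a) (f b)"
  unfolding slin_def by (rule lin_ext_single) simp

lemma slin_slin: "slin W g (slin V f x) = slin (W \<inter> V) (\<lambda>b. slin W g (f b)) x"
  unfolding slin_def[of V] slin_def[of "W \<inter> V"]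
  by (rule lin_ext_natural)
    (simp_all add: slin_add slin_scale kill_vars_kill_vars)

lemma slin_cong: "(\<And>b. b \<in> keys x \<Longrightarrow> f b = g b) \<Longrightarrow> slin W f x = slin W g x"
  unfolding slin_def by (rule lin_ext_cong)

lemma slin_mem: "free.subspace N \<Longrightarrow> (\<And>b. b \<in> keys x \<Longrightarrow> f b \<in> N) \<Longrightarrow> slin W f x \<in> N"
  unfolding slin_def by (rule lin_ext_fscale_mem)

lemma slin_images_diff: "slin W (\<lambda>b. f b - g b) x = slin W f x - slin W g x"
  unfolding slin_def by (rule lin_ext_images_diff) (simp add: free.scale_right_diff_distrib)

definition vars_in :: "'v set \<Rightarrow> (nat \<Rightarrow>\<^sub>0 ('v, 'k::comm_ring_1) mpol) \<Rightarrow> bool" where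
  "vars_in W x \<longleftrightarrow> (\<forall>b. kill_vars W (lookup x b) = lookup x b)"

lemma slin_single_vars_in: "vars_in W x \<Longrightarrow> slin W (\<lambda>b. single b 1) x = x"
  using lin_ext_fscale_single[of x] by (simp add: slin_def lin_ext_def vars_in_def)

lemma lin_ext_image_span: "lin_ext fscale f ` free_on B = free.span (f ` B)"
proof
  show "lin_ext fscale f ` free_on B \<subseteq> free.span (f ` B)"
  proof (rule image_subsetI)
    fix x :: "nat \<Rightarrow>\<^sub>0 'a" assume "x \<in> free_on B"
    then show "lin_ext fscale f x \<in> free.span (f ` B)"
      by (intro lin_ext_fscale_mem[where h = "\<lambda>c. c"] free.subspace_span free.span_base imageI)
        (auto simp: free_on_def)
  qed
  have sub: "free.subspace (lin_ext fscale f ` free_on B)"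
  proof (rule free.subspaceI)
    show "0 \<in> lin_ext fscale f ` free_on B"
      by (rule image_eqI[of _ _ 0]) (auto simp: free_on_def)
    fix y z assume "y \<in> lin_ext fscale f ` free_on B" "z \<in> lin_ext fscale f ` free_on B"
    then obtain u v where uv: "y = lin_ext fscale f u" "z = lin_ext fscale f v"
      "u \<in> free_on B" "v \<in> free_on B" by blast
    have "y + z = lin_ext fscale f (u + v)"
      unfolding uv by (rule lin_ext_add[symmetric]) (simp_all add: free.scale_left_distrib)
    then show "y + z \<in> lin_ext fscale f ` free_on B"
      using uv free.subspace_add[OF subspace_free_on] by blast
  next
    fix c y assume "y \<in> lin_ext fscale f ` free_on B"
    then obtain u where u: "y = lin_ext fscale f u" "u \<in> free_on B" by blast
    have "fscale c y = lin_ext (\<lambda>a. fscale (c * a)) f u"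
      unfolding u by (rule lin_ext_natural) (auto simp: free.scale_right_distrib)
    also have "\<dots> = lin_ext fscale f (fscale c u)"
      by (subst lin_ext_superset[of "keys u" "fscale c u"])
        (auto simp: lin_ext_def in_keys_iff lookup_fscale)
    finally show "fscale c y \<in> lin_ext fscale f ` free_on B"
      using u free.subspace_scale[OF subspace_free_on] by blast
  qed
  have "f b \<in> lin_ext fscale f ` free_on B" if "b \<in> B" for b
    by (rule image_eqI[of _ _ "single b 1"]) (use that in \<open>auto simp: lin_ext_single single_free_on\<close>)
  then show "free.span (f ` B) \<subseteq> lin_ext fscale f ` free_on B"
    by (intro free.span_minimal sub) blast
qed

section \<open>Homogeneous elements of graded free modules\<close>

definition hom_elems ::
  "nat set \<Rightarrow> (nat \<Rightarrow> nat) \<Rightarrow> nat \<Rightarrow> (nat \<Rightarrow>\<^sub>0 ('v, 'k::zero) mpol) set" where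
  "hom_elems B D e = {x \<in> free_on B. \<forall>b. \<forall>m\<in>keys (lookup x b). mdeg m + D b = e}"

lemma hom_elems_free_on: "x \<in> hom_elems B D e \<Longrightarrow> x \<in> free_on B"
  by (simp add: hom_elems_def)

lemma hom_elems_zero: "0 \<in> hom_elems B D e"
  by (simp add: hom_elems_def free_on_def)

lemma hom_elems_add:
  "x \<in> hom_elems B D e \<Longrightarrow> y \<in> hom_elems B D e \<Longrightarrow> x + y \<in> hom_elems B D e"
  unfolding hom_elems_def free_on_def
  by (auto simp: lookup_add dest!: keys_add[THEN subsetD])

lemma hom_elems_diff:
  fixes x :: "nat \<Rightarrow>\<^sub>0 ('v, 'k::comm_ring_1) mpol"
  shows "x \<in> hom_elems B D e \<Longrightarrow> y \<in> hom_elems B D e \<Longrightarrow> x - y \<in> hom_elems B D e"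
  unfolding hom_elems_def free_on_def
  by (auto simp: lookup_minus dest!: keys_diff[THEN subsetD])

lemma hom_elems_scale:
  assumes "y \<in> hom_elems B D d" "\<And>m. m \<in> keys p \<Longrightarrow> mdeg m + d = e"
  shows "fscale p y \<in> hom_elems B D e"
proof -
  have "mdeg m + D b = e" if "m \<in> keys (p * lookup y b)" for b m
  proof -
    from that keys_mult obtain a c where "a \<in> keys p" "c \<in> keys (lookup y b)" "m = a + c"
      by blast
    then show ?thesis
      using assms by (auto simp: hom_elems_def mdeg_add add.assoc)
  qed
  then show ?thesis
    using assms(1) free.subspace_scale[OF subspace_free_on]
    by (auto simp: hom_elems_def lookup_fscale)
qed

lemma hom_elems_sum:
  "(\<And>a. a \<in> A \<Longrightarrow> f a \<in> hom_elems B D e) \<Longrightarrow> sum f A \<in> hom_elems B D e"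
  by (induction A rule: infinite_finite_induct) (auto intro: hom_elems_zero hom_elems_add)

lemma hom_elems_single: "b \<in> B \<Longrightarrow> single b 1 \<in> hom_elems B D (D b)"
  by (auto simp: hom_elems_def single_free_on lookup_single when_def mdeg_def)

lemma slin_hom_elems:
  assumes "x \<in> hom_elems B D e" "\<And>b. b \<in> B \<Longrightarrow> f b \<in> hom_elems B' D' (D b)"
  shows "slin W f x \<in> hom_elems B' D' e"
  unfolding slin_def lin_ext_def
proof (rule hom_elems_sum)
  fix b assume b: "b \<in> keys x"
  then have "b \<in> B" using assms(1) by (auto simp: hom_elems_def free_on_def)
  then show "fscale (kill_vars W (lookup x b)) (f b) \<in> hom_elems B' D' e"
    using assms by (intro hom_elems_scale[of _ _ _ "D b"])
      (auto simp: kill_vars_def keys_pfilter hom_elems_def)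
qed

definition hom_part ::
  "(nat \<Rightarrow> nat) \<Rightarrow> nat \<Rightarrow> (nat \<Rightarrow>\<^sub>0 ('v, 'k::zero) mpol) \<Rightarrow> (nat \<Rightarrow>\<^sub>0 ('v, 'k) mpol)" where
  "hom_part D e x = Poly_Mapping.mapp (\<lambda>b. pfilter (\<lambda>m. mdeg m + D b = e)) x"

lemma lookup_hom_part: "lookup (hom_part D e x) b = pfilter (\<lambda>m. mdeg m + D b = e) (lookup x b)"
  by (simp add: hom_part_def lookup_mapp when_def in_keys_iff)

lemma keys_hom_part: "keys (hom_part D e x) \<subseteq> keys x"
  by (auto simp: in_keys_iff lookup_hom_part)

lemma hom_part_add: "hom_part D e (x + y) = hom_part D e x + hom_part D e (y :: nat \<Rightarrow>\<^sub>0 ('v, 'k::comm_monoid_add) mpol)"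
  by (rule poly_mapping_eqI) (simp add: lookup_hom_part lookup_add pfilter_add)

lemma hom_part_zero [simp]: "hom_part D e 0 = 0"
  by (rule poly_mapping_eqI) (simp add: lookup_hom_part)

lemma hom_part_id: "x \<in> hom_elems B D e \<Longrightarrow> hom_part D e x = x"
  by (rule poly_mapping_eqI) (auto simp: lookup_hom_part hom_elems_def intro: pfilter_id)

lemma hom_part_in_hom_elems: "x \<in> free_on B \<Longrightarrow> hom_part D e x \<in> hom_elems B D e"
  using keys_hom_part[of D e x] by (auto simp: hom_elems_def free_on_def lookup_hom_part keys_pfilter)

lemma hom_part_slin:
  assumes "x \<in> free_on B" "\<And>b. b \<in> B \<Longrightarrow> f b \<in> hom_elems B' D' (D b)"
  shows "hom_part D' e (slin UNIV f x) = slin UNIV f (hom_part D e x)"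
  unfolding slin_UNIV
proof (rule lin_ext_natural)
  fix b assume "b \<in> keys x"
  then have b: "b \<in> B" using assms(1) by (auto simp: free_on_def)
  show "hom_part D' e (fscale (lookup x b) (f b)) = fscale (lookup (hom_part D e x) b) (f b)"
  proof (rule poly_mapping_eqI)
    fix c
    show "lookup (hom_part D' e (fscale (lookup x b) (f b))) c
        = lookup (fscale (lookup (hom_part D e x) b) (f b)) c"
      unfolding lookup_hom_part lookup_fscale
      by (rule pfilter_mult) (use assms(2)[OF b] in \<open>auto simp: hom_elems_def mdeg_add add.assoc\<close>)
  qed
qed (auto simp: hom_part_add keys_hom_part)

text \<open>If the terms of \<open>x\<close> (a monomial \<open>m\<close> in the coordinate \<open>b\<close>) are sorted by a label \<open>\<kappa> b m\<close>, then \<open>x\<close>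
  is the sum of its parts, only finitely many of which matter. The labels in use are the degree and the
  part of the monomial outside \<open>W\<close>.\<close>

lemma sum_graded_parts:
  fixes x :: "nat \<Rightarrow>\<^sub>0 ('v, 'k::comm_monoid_add) mpol"
  assumes part: "\<And>e b m. lookup (lookup (part e) b) m = (if e = \<kappa> b m then lookup (lookup x b) m else 0)"
  shows "\<exists>E. finite E \<and> E \<subseteq> {\<kappa> b m | b m. True} \<and> x = (\<Sum>e\<in>E. part e)"
proof (intro exI conjI)
  let ?E = "\<Union>b\<in>keys x. \<kappa> b ` keys (lookup x b)"
  show fin: "finite ?E" by auto
  show "?E \<subseteq> {\<kappa> b m | b m. True}" by auto
  show "x = (\<Sum>e\<in>?E. part e)"
  proof (intro poly_mapping_eqI)
    fix b m
    have "lookup (lookup (\<Sum>e\<in>?E. part e) b) m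
        = (\<Sum>e\<in>?E. if e = \<kappa> b m then lookup (lookup x b) m else 0)"
      unfolding lookup_sum part ..
    also have "\<dots> = (if \<kappa> b m \<in> ?E then lookup (lookup x b) m else 0)"
      by (rule sum.delta) (rule fin)
    also have "\<dots> = lookup (lookup x b) m"
    proof (cases "lookup (lookup x b) m = 0")
      case False
      then have "b \<in> keys x" "m \<in> keys (lookup x b)" by (auto simp: in_keys_iff)
      then have "\<kappa> b m \<in> ?E" by blast
      then show ?thesis by simp
    qed simp
    finally show "lookup (lookup x b) m = lookup (lookup (\<Sum>e\<in>?E. part e) b) m" by simp
  qed
qed

section \<open>Kernels are generated by homogeneous elements of the smaller ring\<close>

definition hom_in_vars :: "'v set \<Rightarrow> nat set \<Rightarrow> (nat \<Rightarrow> nat) \<Rightarrow> nat \<Rightarrow> (nat \<Rightarrow>\<^sub>0 ('v, 'k::comm_ring_1) mpol) set" where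
  "hom_in_vars W B D e = {y \<in> hom_elems B D e. vars_in W y}"

text \<open>The property that is carried along the construction of a resolution: it holds for the ideal to
  be resolved and passes from each syzygy module to the next.\<close>

definition hom_generated :: "'v set \<Rightarrow> nat set \<Rightarrow> (nat \<Rightarrow> nat) \<Rightarrow>
    (nat \<Rightarrow>\<^sub>0 ('v, 'k::comm_ring_1) mpol) set \<Rightarrow> bool" where
  "hom_generated W B D N \<longleftrightarrow> free.subspace N \<and> N = free.span (\<Union>e. N \<inter> hom_in_vars W B D e)"

lemma slin_outside_coeff:
  assumes c: "keys c \<inter> W = {}" and f: "\<And>b. b \<in> keys x \<Longrightarrow> vars_in W (f b)"
  shows "slin UNIV f (Poly_Mapping.map (outside_coeff W c) x)
       = Poly_Mapping.map (outside_coeff W c) (slin UNIV f x)"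
  unfolding slin_UNIV
proof (rule lin_ext_natural[symmetric])
  fix b assume b: "b \<in> keys x"
  show "Poly_Mapping.map (outside_coeff W c) (fscale (lookup x b) (f b))
      = fscale (lookup (Poly_Mapping.map (outside_coeff W c) x) b) (f b)"
    by (rule poly_mapping_eqI)
      (use f[OF b] in \<open>simp add: lookup_map_zero lookup_fscale vars_in_def outside_coeff_mult[OF c]\<close>)
qed (auto simp: keys_map_subset intro!: poly_mapping_eqI simp: lookup_map_zero lookup_add outside_coeff_add)

text \<open>A matrix that is homogeneous and has entries in \<open>k[W]\<close> commutes with taking homogeneous parts and,
  over \<open>k[W]\<close>, with taking coordinates. So both operations preserve its kernel, and every kernel
  element is a combination \<open>\<Sum> c z\<^sub>c\<close> of homogeneous kernel elements \<open>z\<^sub>c\<close> over \<open>k[W]\<close>, with monomials \<open>c\<close>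
  outside \<open>W\<close> as coefficients. This replaces the flatness of \<open>S\<close> over \<open>k[W]\<close>.\<close>

lemma kernel_hom_generated:
  fixes f :: "nat \<Rightarrow> (nat \<Rightarrow>\<^sub>0 ('v, 'k::comm_ring_1) mpol)"
  assumes f: "\<And>b. b \<in> B \<Longrightarrow> f b \<in> hom_in_vars W B' D' (D b)"
  shows "hom_generated W B D {x \<in> free_on B. slin UNIV f x = 0}"
    (is "hom_generated W B D ?N")
proof -
  have sub: "free.subspace ?N"
    using subspace_free_on[of B]
    by (auto simp: free.subspace_def slin_add slin_scale)
  have homog: "y \<in> free.span (\<Union>e. ?N \<inter> hom_in_vars W B D e)"
    if y: "y \<in> ?N" "y \<in> hom_elems B D e" for y e
  proof -
    have part: "lookup (lookup (fscale (single c 1) (Poly_Mapping.map (outside_coeff W c) y)) b) m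
        = (if c = pfilter (\<lambda>v. v \<notin> W) m then lookup (lookup y b) m else 0)"
      if c: "keys c \<inter> W = {}" for c b m
      using c by (auto simp: lookup_fscale lookup_map_zero monomial_times_outside_coeff lookup_pfilter)
    let ?part = "\<lambda>c. if keys c \<inter> W = {}
      then fscale (single c 1) (Poly_Mapping.map (outside_coeff W c) y) else 0"
    \<comment> \<open>All labels that occur are monomials outside \<open>W\<close>; 0 is a default for the others.\<close>
    have "\<exists>C. finite C \<and> C \<subseteq> {pfilter (\<lambda>v. v \<notin> W) m | (b :: nat) m. True} \<and> y = (\<Sum>c\<in>C. ?part c)"
      by (rule sum_graded_parts) (auto simp: part keys_pfilter)
    then obtain C where C: "y = (\<Sum>c\<in>C. ?part c)" by blast
    have "?part c \<in> free.span (\<Union>e. ?N \<inter> hom_in_vars W B D e)" for c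
    proof (cases "keys c \<inter> W = {}")
      case True
      let ?z = "Poly_Mapping.map (outside_coeff W c) y"
      have yB: "y \<in> free_on B" using y(1) by simp
      have "slin UNIV f ?z = Poly_Mapping.map (outside_coeff W c) (slin UNIV f y)"
        by (rule slin_outside_coeff[OF True]) (use f yB in \<open>auto simp: free_on_def hom_in_vars_def\<close>)
      also have "\<dots> = 0"
        using y(1) by (intro poly_mapping_eqI) (simp add: lookup_map_zero)
      finally have "slin UNIV f ?z = 0" .
      moreover have zB: "?z \<in> free_on B"
        using yB keys_map_subset[of "outside_coeff W c" y] by (auto simp: free_on_def)
      moreover have "vars_in W ?z"
        by (simp add: vars_in_def lookup_map_zero)
      \<comment> \<open>The difference is truncated only if \<open>mdeg c > e\<close>; then \<open>?z\<close> is zero and has every degree.\<close>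
      moreover have "?z \<in> hom_elems B D (e - mdeg c)"
      proof -
        have "mdeg m + D b = e - mdeg c" if "m \<in> keys (lookup ?z b)" for b m
        proof -
          from that have "c + m \<in> keys (lookup y b)"
            by (auto simp: in_keys_iff lookup_map_zero lookup_outside_coeff split: if_splits)
          then have "mdeg (c + m) + D b = e"
            using y(2) by (auto simp: hom_elems_def)
          then show ?thesis by (simp add: mdeg_add)
        qed
        then show ?thesis using zB by (simp add: hom_elems_def)
      qed
      ultimately have "?z \<in> ?N \<inter> hom_in_vars W B D (e - mdeg c)"
        by (simp add: hom_in_vars_def)
      then have "fscale (single c 1) ?z \<in> free.span (\<Union>e. ?N \<inter> hom_in_vars W B D e)"
        by (intro free.span_scale free.span_base) blast
      then show ?thesis using True by simp
    next
      case False
      then show ?thesis by (simp add: free.span_zero)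
    qed
    then have "(\<Sum>c\<in>C. ?part c) \<in> free.span (\<Union>e. ?N \<inter> hom_in_vars W B D e)"
      by (rule free.span_sum)
    then show ?thesis using C by simp
  qed
  have "x \<in> free.span (\<Union>e. ?N \<inter> hom_in_vars W B D e)" if x: "x \<in> ?N" for x
  proof -
    have "\<exists>E. finite E \<and> E \<subseteq> {mdeg m + D b | b (m :: 'v \<Rightarrow>\<^sub>0 nat). True} \<and> x = (\<Sum>e\<in>E. hom_part D e x)"
      by (rule sum_graded_parts) (auto simp: lookup_hom_part lookup_pfilter)
    then obtain E where E: "x = (\<Sum>e\<in>E. hom_part D e x)" by blast
    have "hom_part D e x \<in> free.span (\<Union>e. ?N \<inter> hom_in_vars W B D e)" for e
    proof (rule homog)
      show mem: "hom_part D e x \<in> hom_elems B D e"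
        using x by (intro hom_part_in_hom_elems) simp
      have "slin UNIV f (hom_part D e x) = hom_part D' e (slin UNIV f x)"
        by (rule hom_part_slin[symmetric, of x B]) (use x f in \<open>auto simp: hom_in_vars_def\<close>)
      then show "hom_part D e x \<in> ?N"
        using x hom_elems_free_on[OF mem] by simp
    qed
    then have "(\<Sum>e\<in>E. hom_part D e x) \<in> free.span (\<Union>e. ?N \<inter> hom_in_vars W B D e)"
      by (rule free.span_sum)
    then show ?thesis using E by simp
  qed
  moreover have "free.span (\<Union>e. ?N \<inter> hom_in_vars W B D e) \<subseteq> ?N"
    by (rule free.span_minimal[OF _ sub]) blast
  ultimately show ?thesis
    using sub unfolding hom_generated_def by blast
qed

section \<open>Existence of resolutions\<close>

lemma vector_space_graded_piece:
  "vector_space (\<lambda>(a :: 'k::field) (x :: nat \<Rightarrow>\<^sub>0 ('v, 'k) mpol). fscale (single 0 a) x)"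
  by unfold_locales
    (simp_all add: free.scale_right_distrib free.scale_left_distrib single_add mult_single)

lemma hom_elems_finite_dim:
  fixes D :: "nat \<Rightarrow> nat"
  assumes fin: "\<And>j. finite {b \<in> B. D b = j}"
  shows "\<exists>T. finite T \<and> (hom_elems B D e :: (nat \<Rightarrow>\<^sub>0 ('v::finite, 'k::field) mpol) set)
    \<subseteq> module.span (\<lambda>a. fscale (single 0 a)) T"
proof (intro exI conjI)
  interpret graded: vector_space "\<lambda>(a :: 'k) (x :: nat \<Rightarrow>\<^sub>0 ('v, 'k) mpol). fscale (single 0 a) x"
    by (rule vector_space_graded_piece)
  let ?P = "(\<Union>j\<le>e. {b \<in> B. D b = j}) \<times> (\<Union>j\<le>e. {m :: 'v \<Rightarrow>\<^sub>0 nat. mdeg m = j})"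
  let ?T = "(\<lambda>(b, m). single b (single m (1 :: 'k))) ` ?P"
  have "finite ?P"
    using fin finite_monomials_of_degree by (intro finite_cartesian_product finite_UN_I) auto
  then show "finite ?T" by (rule finite_imageI)
  show "hom_elems B D e \<subseteq> graded.span ?T"
  proof
    fix x :: "nat \<Rightarrow>\<^sub>0 ('v, 'k) mpol" assume x: "x \<in> hom_elems B D e"
    have expand: "p = (\<Sum>b\<in>keys p. single b (lookup p b))" for p :: "'c \<Rightarrow>\<^sub>0 'd::comm_monoid_add"
      by (rule poly_mapping_eqI) (simp add: lookup_sum lookup_single when_def in_keys_iff)
    have single_sum: "single b (sum g A) = (\<Sum>a\<in>A. single b (g a))"
      for b :: nat and g :: "('v \<Rightarrow>\<^sub>0 nat) \<Rightarrow> ('v, 'k) mpol" and A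
      by (induction A rule: infinite_finite_induct) (auto simp: single_add)
    have "single b (lookup x b) \<in> graded.span ?T" if b: "b \<in> keys x" for b
    proof -
      have "single b (single m (lookup (lookup x b) m)) \<in> graded.span ?T"
        if m: "m \<in> keys (lookup x b)" for m
      proof -
        have "mdeg m + D b = e" "b \<in> B"
          using x b m by (auto simp: hom_elems_def free_on_def)
        then have "(b, m) \<in> ?P" by auto
        then have mem: "single b (single m 1) \<in> ?T" by force
        have "single b (single m (lookup (lookup x b) m))
            = fscale (single 0 (lookup (lookup x b) m)) (single b (single m 1))"
          by (rule poly_mapping_eqI) (simp add: lookup_fscale lookup_single when_def mult_single)
        then show ?thesis
          using graded.span_scale[OF graded.span_base[OF mem]] by simp
      qed
      then have "(\<Sum>m\<in>keys (lookup x b). single b (single m (lookup (lookup x b) m))) \<in> graded.span ?T"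
        by (rule graded.span_sum)
      then show ?thesis
        using expand[of "lookup x b"] single_sum by metis
    qed
    then have "(\<Sum>b\<in>keys x. single b (lookup x b)) \<in> graded.span ?T"
      by (rule graded.span_sum)
    then show "x \<in> graded.span ?T"
      using expand[of x] by simp
  qed
qed

text \<open>Generators are taken to be the union of \<open>k\<close>-bases of the graded components of the generating
  homogeneous elements. Each of these bases is finite, so the union is countable and can be indexed
  by natural numbers.\<close>

lemma free_cover:
  fixes N :: "(nat \<Rightarrow>\<^sub>0 ('v::finite, 'k::field) mpol) set"
  assumes N: "hom_generated W B D N" and fin: "\<And>j. finite {b \<in> B. D b = j}"
  shows "\<exists>B' D' f. (\<forall>j. finite {b \<in> B'. D' b = j}) \<and> (\<forall>b\<in>B'. f b \<in> hom_in_vars W B D (D' b))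
    \<and> slin UNIV f ` free_on B' = N"
proof -
  interpret graded: vector_space "\<lambda>(a :: 'k) (x :: nat \<Rightarrow>\<^sub>0 ('v, 'k) mpol). fscale (single 0 a) x"
    by (rule vector_space_graded_piece)
  have "\<exists>U. finite U \<and> U \<subseteq> N \<inter> hom_in_vars W B D e \<and> N \<inter> hom_in_vars W B D e \<subseteq> graded.span U" for e
  proof -
    obtain U where U: "U \<subseteq> N \<inter> hom_in_vars W B D e" "graded.independent U"
      "N \<inter> hom_in_vars W B D e \<subseteq> graded.span U"
      by (rule graded.basis_exists)
    obtain T where T: "finite T" "(hom_elems B D e :: (nat \<Rightarrow>\<^sub>0 ('v, 'k) mpol) set) \<subseteq> graded.span T"
      using hom_elems_finite_dim[OF fin, of e] by blast
    have "U \<subseteq> graded.span T" using U(1) T(2) by (auto simp: hom_in_vars_def)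
    then have "finite U" using graded.independent_span_bound[OF T(1) U(2)] by blast
    then show ?thesis using U by blast
  qed
  then obtain U where U: "\<And>e. finite (U e)" "\<And>e. U e \<subseteq> N \<inter> hom_in_vars W B D e"
    "\<And>e. N \<inter> hom_in_vars W B D e \<subseteq> graded.span (U e)" by metis
  \<comment> \<open>Generators are paired with their degree, so that a code determines both.\<close>
  define P where "P = (SIGMA e:UNIV. U e)"
  have P: "countable P"
    unfolding P_def using U(1) by (intro countable_SIGMA) (auto intro: countable_finite)
  define B' where "B' = to_nat_on P ` P"
  define D' where "D' n = fst (from_nat_into P n)" for n
  define f where "f n = snd (from_nat_into P n)" for n
  have code: "D' (to_nat_on P q) = fst q" "f (to_nat_on P q) = snd q" if "q \<in> P" for q
    using from_nat_into_to_nat_on[OF P that] by (auto simp: D'_def f_def)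
  have "{b \<in> B'. D' b = j} \<subseteq> (\<lambda>u. to_nat_on P (j, u)) ` U j" for j
    using code by (auto simp: B'_def P_def)
  then have "finite {b \<in> B'. D' b = j}" for j
    using finite_subset U(1) by blast
  moreover have "f b \<in> hom_in_vars W B D (D' b)" if "b \<in> B'" for b
  proof -
    obtain q where "q \<in> P" "b = to_nat_on P q" using \<open>b \<in> B'\<close> unfolding B'_def by blast
    moreover from this have "snd q \<in> hom_in_vars W B D (fst q)"
      using U(2) unfolding P_def by fastforce
    ultimately show ?thesis
      using code by simp
  qed
  moreover have "slin UNIV f ` free_on B' = N"
  proof -
    have img: "f ` B' = (\<Union>e. U e)"
      unfolding B'_def image_image using code by (force simp: P_def)
    have "graded.span (U e) \<subseteq> free.span (\<Union>e. U e)" for e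
    proof (rule graded.span_minimal)
      show "U e \<subseteq> free.span (\<Union>e. U e)"
        using free.span_superset by blast
      show "graded.subspace (free.span (\<Union>e. U e))"
        by (auto simp: graded.subspace_def free.span_zero free.span_add free.span_scale)
    qed
    then have "(\<Union>e. N \<inter> hom_in_vars W B D e) \<subseteq> free.span (\<Union>e. U e)"
      using U(3) by blast
    then have "free.span (\<Union>e. N \<inter> hom_in_vars W B D e) \<subseteq> free.span (\<Union>e. U e)"
      by (rule free.span_minimal) simp
    moreover have "free.span (\<Union>e. U e) \<subseteq> free.span (\<Union>e. N \<inter> hom_in_vars W B D e)"
      using U(2) by (intro free.span_mono) blast
    moreover have "N = free.span (\<Union>e. N \<inter> hom_in_vars W B D e)"
      using N unfolding hom_generated_def by (elim conjE)
    ultimately have "free.span (\<Union>e. U e) = N" by blast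
    then show ?thesis
      unfolding slin_UNIV lin_ext_image_span img .
  qed
  ultimately show ?thesis by blast
qed

text \<open>Cycles of the augmented complex, with \<open>S/I\<close> in position \<open>-1\<close>; this makes exactness one condition
  for all \<open>i\<close>.\<close>

definition cycles :: "('v, 'k::field) mpol set \<Rightarrow> ('v, 'k) free_cplx \<Rightarrow> nat
    \<Rightarrow> (nat \<Rightarrow>\<^sub>0 ('v, 'k) mpol) set" where
  "cycles I F i = {x \<in> free_on (basis F i).
     case i of 0 \<Rightarrow> augm_map F x \<in> I | Suc i' \<Rightarrow> slin UNIV (bdry F i') x = 0}"

lemma graded_free_resolution_iff:
  "graded_free_resolution I F \<longleftrightarrow>
     (\<forall>i j. finite {b \<in> basis F i. bdeg F i b = j}) \<and>
     (\<forall>b\<in>basis F 0. homogeneous (bdeg F 0 b) (augm F b)) \<and>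
     (\<forall>i. \<forall>b\<in>basis F (Suc i). bdry F i b \<in> hom_elems (basis F i) (bdeg F i) (bdeg F (Suc i) b)) \<and>
     (\<forall>p. \<exists>x\<in>free_on (basis F 0). augm_map F x - p \<in> I) \<and>
     (\<forall>i. cycles I F i = slin UNIV (bdry F i) ` free_on (basis F (Suc i)))"
proof -
  have hom: "(x \<in> free_on B \<and> (\<forall>c\<in>B. \<forall>m\<in>keys (lookup x c). mdeg m + D c = e))
      \<longleftrightarrow> x \<in> hom_elems B D e" for x :: "nat \<Rightarrow>\<^sub>0 ('v, 'k::field) mpol" and B D e
  proof -
    have "c \<in> B" if "keys x \<subseteq> B" "m \<in> keys (lookup x c)" for c m
      using that by (cases "c \<in> keys x") (auto simp: in_keys_iff)
    then show ?thesis
      unfolding hom_elems_def free_on_def by blast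
  qed
  have all: "(\<forall>i. R i) \<longleftrightarrow> R 0 \<and> (\<forall>i. R (Suc i))" for R :: "nat \<Rightarrow> bool"
    by (metis not0_implies_Suc)
  show ?thesis
    unfolding graded_free_resolution_def hom all[of "\<lambda>i. cycles I F i = _ i"]
    by (simp add: cycles_def bdry_map_def slin_UNIV)
qed

text \<open>Start from \<open>S \<rightarrow> S/I\<close> and cover each module of syzygies by a free module, alternating
  \<open>free_cover\<close> with \<open>kernel_hom_generated\<close>.\<close>

lemma resolution_exists:
  fixes I :: "('v::finite, 'k::field) mpol set"
  assumes I: "I = ideal_gen A"
    and A: "\<And>a. a \<in> A \<Longrightarrow> kill_vars W a = a \<and> (\<exists>e. homogeneous e a)"
  shows "\<exists>F. graded_free_resolution I F \<and> (\<forall>i. \<forall>b\<in>basis F (Suc i). vars_in W (bdry F i b))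
    \<and> (\<forall>b\<in>basis F 0. kill_vars W (augm F b) = augm F b)"
proof -
  define N0 :: "(nat \<Rightarrow>\<^sub>0 ('v, 'k) mpol) set" where "N0 = {x \<in> free_on {0}. lookup x 0 \<in> I}"
  have subI: "ideal.subspace I" by (simp add: I ideal_gen_def)
  have sub0: "free.subspace N0"
    unfolding N0_def free.subspace_def
    using ideal.subspace_0[OF subI] ideal.subspace_add[OF subI] ideal.subspace_scale[OF subI]
    by (auto simp: lookup_add lookup_fscale intro: free.subspace_0[OF subspace_free_on]
        free.subspace_add[OF subspace_free_on] free.subspace_scale[OF subspace_free_on])
  have N0: "hom_generated W {0} (\<lambda>_. 0) N0"
    unfolding hom_generated_def
  proof (intro conjI sub0 equalityI)
    let ?S = "free.span (\<Union>e. N0 \<inter> hom_in_vars W {0} (\<lambda>_. 0) e)"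
    show "?S \<subseteq> N0" by (rule free.span_minimal[OF _ sub0]) blast
    have sub: "ideal.subspace {p. single 0 p \<in> ?S}"
    proof (rule ideal.subspaceI)
      fix c p assume "p \<in> {p. single 0 p \<in> ?S}"
      then have "fscale c (single 0 p) \<in> ?S" by (intro free.span_scale) simp
      moreover have "fscale c (single 0 p) = single (0 :: nat) (c * p)"
        by (rule poly_mapping_eqI) (simp add: lookup_fscale lookup_single when_def)
      ultimately show "c * p \<in> {p. single 0 p \<in> ?S}" by simp
    qed (auto simp: single_add free.span_zero free.span_add)
    have "A \<subseteq> {p. single 0 p \<in> ?S}"
    proof
      fix a assume a: "a \<in> A"
      then obtain e where e: "homogeneous e a" using A by blast
      have "a \<in> I" using a unfolding I ideal_gen_def by (rule ideal.span_base)
      then have "single 0 a \<in> N0" by (simp add: N0_def single_free_on)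
      moreover have "single 0 a \<in> hom_in_vars W {0} (\<lambda>_. 0) e"
        using e A[OF a]
        by (auto simp: hom_in_vars_def hom_elems_def single_free_on vars_in_def lookup_single when_def
            homogeneous_def)
      ultimately have "single 0 a \<in> (\<Union>e. N0 \<inter> hom_in_vars W {0} (\<lambda>_. 0) e)" by blast
      then show "a \<in> {p. single 0 p \<in> ?S}"
        by (intro CollectI free.span_base)
    qed
    then have gen: "I \<subseteq> {p. single 0 p \<in> ?S}"
      unfolding I ideal_gen_def by (rule ideal.span_minimal[OF _ sub])
    have "x = single 0 (lookup x 0)" if "x \<in> free_on {0}" for x :: "nat \<Rightarrow>\<^sub>0 ('v, 'k) mpol"
    proof (rule poly_mapping_eqI)
      fix b
      have "lookup x b = 0" if "b \<noteq> 0"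
        using that \<open>x \<in> free_on {0}\<close> by (auto simp: free_on_def in_keys_iff)
      then show "lookup x b = lookup (single 0 (lookup x 0)) b"
        by (simp add: lookup_single when_def)
    qed
    note single = this
    show "N0 \<subseteq> ?S"
    proof
      fix x assume "x \<in> N0"
      then have x: "x \<in> free_on {0}" "lookup x 0 \<in> I" by (simp_all add: N0_def)
      then have "single 0 (lookup x 0) \<in> ?S" using gen by blast
      then show "x \<in> ?S" using single[OF x(1)] by simp
    qed
  qed
  \<comment> \<open>A state \<open>(B, D, f, N)\<close> records the basis and its degrees, the map into the previous free module, and
    the syzygies that still have to be covered; in the initial state the map is a dummy.\<close>
  define P where "P n s \<longleftrightarrow> (case s of (B, D, f, N) \<Rightarrow>
      (\<forall>j. finite {b \<in> B. D b = j}) \<and> hom_generated W B D N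
      \<and> (n = 0 \<longrightarrow> B = {0} \<and> D = (\<lambda>_. 0) \<and> N = N0))"
    for n :: nat and s :: "nat set \<times> (nat \<Rightarrow> nat) \<times> (nat \<Rightarrow> nat \<Rightarrow>\<^sub>0 ('v, 'k) mpol)
      \<times> (nat \<Rightarrow>\<^sub>0 ('v, 'k) mpol) set"
  define Q where "Q n s t \<longleftrightarrow> (case s of (B, D, f, N) \<Rightarrow> case t of (B', D', f', N') \<Rightarrow>
      (\<forall>b\<in>B'. f' b \<in> hom_in_vars W B D (D' b)) \<and> slin UNIV f' ` free_on B' = N
      \<and> N' = {x \<in> free_on B'. slin UNIV f' x = 0})"
    for n :: nat and s t :: "nat set \<times> (nat \<Rightarrow> nat) \<times> (nat \<Rightarrow> nat \<Rightarrow>\<^sub>0 ('v, 'k) mpol)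
      \<times> (nat \<Rightarrow>\<^sub>0 ('v, 'k) mpol) set"
  have "\<exists>s. \<forall>n. P n (s n) \<and> Q n (s n) (s (Suc n))"
  proof (rule dependent_nat_choice)
    show "\<exists>s. P 0 s"
      by (rule exI[of _ "({0}, \<lambda>_. 0, \<lambda>_. 0, N0)"]) (simp add: P_def N0)
  next
    fix s n assume "P n s"
    then obtain B D f N where s: "s = (B, D, f, N)" "\<And>j. finite {b \<in> B. D b = j}"
      "hom_generated W B D N" by (auto simp: P_def split: prod.splits)
    obtain B' D' f' where t: "\<And>j. finite {b \<in> B'. D' b = j}"
      "\<And>b. b \<in> B' \<Longrightarrow> f' b \<in> hom_in_vars W B D (D' b)" "slin UNIV f' ` free_on B' = N"
      using free_cover[OF s(3,2)] by blast
    have "hom_generated W B' D' {x \<in> free_on B'. slin UNIV f' x = 0}"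
      by (rule kernel_hom_generated) (rule t(2))
    then have "P (Suc n) (B', D', f', {x \<in> free_on B'. slin UNIV f' x = 0})"
      "Q n s (B', D', f', {x \<in> free_on B'. slin UNIV f' x = 0})"
      using t by (simp_all add: P_def Q_def s(1))
    then show "\<exists>t. P (Suc n) t \<and> Q n s t" by blast
  qed
  then obtain s where s: "\<And>n. P n (s n)" "\<And>n. Q n (s n) (s (Suc n))" by blast
  define B where "B n = fst (s n)" for n
  define D where "D n = fst (snd (s n))" for n
  define f where "f n = fst (snd (snd (s n)))" for n
  define N where "N n = snd (snd (snd (s n)))" for n
  have sn: "s n = (B n, D n, f n, N n)" for n
    by (simp add: B_def D_def f_def N_def)
  have fin: "finite {b \<in> B n. D n b = j}" for n j
    using s(1)[of n] by (simp add: P_def sn)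
  have zero: "B 0 = {0}" "D 0 = (\<lambda>_. 0)" "N 0 = N0"
    using s(1)[of 0] by (simp_all add: P_def sn)
  have step: "b \<in> B (Suc n) \<Longrightarrow> f (Suc n) b \<in> hom_in_vars W (B n) (D n) (D (Suc n) b)"
    "slin UNIV (f (Suc n)) ` free_on (B (Suc n)) = N n"
    "N (Suc n) = {x \<in> free_on (B (Suc n)). slin UNIV (f (Suc n)) x = 0}" for n b
    using s(2)[of n] by (simp_all add: Q_def sn)
  define F where "F = \<lparr>basis = B, bdeg = D, bdry = (\<lambda>n. f (Suc n)), augm = (\<lambda>_. 1 :: ('v, 'k) mpol)\<rparr>"
  have augm: "augm_map F x = lookup x 0" if "x \<in> free_on {0}" for x
    using that unfolding augm_map_def F_def free_on_def
    by (subst lin_ext_superset[of "{0}"]) auto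
  have "graded_free_resolution I F"
    unfolding graded_free_resolution_iff
  proof (intro conjI allI ballI)
    fix i j show "finite {b \<in> basis F i. bdeg F i b = j}"
      by (simp add: F_def fin)
  next
    fix b assume "b \<in> basis F 0"
    show "homogeneous (bdeg F 0 b) (augm F b)"
      by (simp add: F_def zero homogeneous_def mdeg_def)
  next
    fix i b assume "b \<in> basis F (Suc i)"
    then show "bdry F i b \<in> hom_elems (basis F i) (bdeg F i) (bdeg F (Suc i) b)"
      using step(1)[of b i] by (simp add: F_def hom_in_vars_def)
  next
    fix p
    show "\<exists>x\<in>free_on (basis F 0). augm_map F x - p \<in> I"
      using ideal.subspace_0[OF subI]
      by (intro bexI[of _ "single 0 p"])
        (simp_all add: augm single_free_on F_def zero augm[unfolded F_def])
  next
    fix i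
    have "cycles I F i = N i"
    proof (cases i)
      case 0
      then show ?thesis using augm by (auto simp: cycles_def zero N0_def F_def)
    next
      case (Suc i')
      then show ?thesis by (simp add: cycles_def step(3)) (simp add: F_def)
    qed
    then show "cycles I F i = slin UNIV (bdry F i) ` free_on (basis F (Suc i))"
      using step(2)[of i] by (simp add: F_def)
  qed
  moreover have "vars_in W (bdry F i b)" if "b \<in> basis F (Suc i)" for i b
    using step(1)[of b i] that by (simp add: F_def hom_in_vars_def)
  moreover have "kill_vars W (augm F b) = augm F b" for b
    by (simp add: F_def)
  ultimately show ?thesis by blast
qed

section \<open>Powers of LSS-ideals\<close>

lemma ideal_gen_minimal: "A \<subseteq> J \<Longrightarrow> ideal.subspace J \<Longrightarrow> ideal_gen A \<subseteq> J"
  unfolding ideal_gen_def by (rule ideal.span_minimal)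

lemma ideal_gen_base: "A \<subseteq> ideal_gen A"
  unfolding ideal_gen_def by (rule ideal.span_superset)

lemma ideal_gen_mono: "A \<subseteq> B \<Longrightarrow> ideal_gen A \<subseteq> ideal_gen B"
  unfolding ideal_gen_def by (rule ideal.span_mono)

lemma subspace_ideal_gen: "ideal.subspace (ideal_gen A)"
  unfolding ideal_gen_def by (rule ideal.subspace_span)

lemma subspace_colon:
  assumes "ideal.subspace J"
  shows "ideal.subspace {a. a * b \<in> J}"
proof (rule ideal.subspaceI)
  show "0 \<in> {a. a * b \<in> J}"
    using ideal.subspace_0[OF assms] by simp
next
  fix x y assume "x \<in> {a. a * b \<in> J}" "y \<in> {a. a * b \<in> J}"
  then have "x * b + y * b \<in> J" using ideal.subspace_add[OF assms] by simp
  then show "x + y \<in> {a. a * b \<in> J}" by (simp only: distrib_right mem_Collect_eq)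
next
  fix c x assume "x \<in> {a. a * b \<in> J}"
  then have "x * b \<in> J" by simp
  then have "c * (x * b) \<in> J" by (rule ideal.subspace_scale[OF assms])
  then show "c * x \<in> {a. a * b \<in> J}" by (simp only: mult.assoc mem_Collect_eq)
qed

text \<open>A fixed factor multiplies an ideal into another one as soon as it does so with generators; this
  is applied to one factor at a time.\<close>

lemma ideal_gen_products:
  "ideal_gen {a * b | a b. a \<in> ideal_gen A \<and> b \<in> ideal_gen B}
     = ideal_gen {a * b | a b. a \<in> A \<and> b \<in> (B :: 'r::comm_ring_1 set)}" (is "_ = ideal_gen ?AB")
proof
  have left: "ideal_gen A \<subseteq> {a. a * b \<in> ideal_gen ?AB}" if b: "b \<in> B" for b
  proof (rule ideal_gen_minimal)
    show "A \<subseteq> {a. a * b \<in> ideal_gen ?AB}"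
      using b ideal_gen_base[of ?AB] by blast
  qed (intro subspace_colon subspace_ideal_gen)
  have right: "ideal_gen B \<subseteq> {b. b * a \<in> ideal_gen ?AB}" if a: "a \<in> ideal_gen A" for a
  proof (rule ideal_gen_minimal)
    show "B \<subseteq> {b. b * a \<in> ideal_gen ?AB}"
      using a left by (auto simp: mult.commute)
  qed (intro subspace_colon subspace_ideal_gen)
  have "{a * b | a b. a \<in> ideal_gen A \<and> b \<in> ideal_gen B} \<subseteq> ideal_gen ?AB"
    using right by (auto simp: mult.commute)
  then show "ideal_gen {a * b | a b. a \<in> ideal_gen A \<and> b \<in> ideal_gen B} \<subseteq> ideal_gen ?AB"
    by (rule ideal_gen_minimal) (rule subspace_ideal_gen)
  show "ideal_gen ?AB \<subseteq> ideal_gen {a * b | a b. a \<in> ideal_gen A \<and> b \<in> ideal_gen B}"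
    using ideal_gen_base[of A] ideal_gen_base[of B] by (intro ideal_gen_mono) blast
qed

lemma homogeneous_mult:
  "homogeneous d p \<Longrightarrow> homogeneous e q \<Longrightarrow> homogeneous (d + e) (p * q :: ('v, 'k::comm_ring_1) mpol)"
  using keys_mult[of p q] by (auto simp: homogeneous_def mdeg_add)

lemma ideal_pow_hom_generators:
  fixes A :: "('v, 'k::comm_ring_1) mpol set"
  assumes A: "\<And>a. a \<in> A \<Longrightarrow> kill_vars W a = a \<and> (\<exists>e. homogeneous e a)"
  shows "\<exists>A'. ideal_pow (ideal_gen A) s = ideal_gen A'
    \<and> (\<forall>a\<in>A'. kill_vars W a = a \<and> (\<exists>e. homogeneous e a))"
proof (induction s)
  case 0
  have "UNIV = ideal_gen {1 :: ('v, 'k) mpol}"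
    by (auto simp: ideal_gen_def ideal.span_singleton image_iff)
  moreover have "homogeneous 0 (1 :: ('v, 'k) mpol)"
    by (simp add: homogeneous_def mdeg_def)
  ultimately show ?case
    by (intro exI[of _ "{1}"]) auto
next
  case (Suc s)
  then obtain A' where A': "ideal_pow (ideal_gen A) s = ideal_gen A'"
    "\<And>a. a \<in> A' \<Longrightarrow> kill_vars W a = a \<and> (\<exists>e. homogeneous e a)" by blast
  show ?case
  proof (rule exI[of _ "{a * b | a b. a \<in> A \<and> b \<in> A'}"], intro conjI ballI)
    show "ideal_pow (ideal_gen A) (Suc s) = ideal_gen {a * b | a b. a \<in> A \<and> b \<in> A'}"
      by (simp add: A'(1) ideal_gen_products)
    fix p assume "p \<in> {a * b | a b. a \<in> A \<and> b \<in> A'}"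
    then obtain a b where p: "p = a * b" "a \<in> A" "b \<in> A'" by blast
    show "kill_vars W p = p"
      using A[OF p(2)] A'(2)[OF p(3)] by (simp add: p(1) kill_vars_mult)
    show "\<exists>e. homogeneous e p"
      using A[OF p(2)] A'(2)[OF p(3)] homogeneous_mult unfolding p(1) by blast
  qed
qed

lemma ideal_pow_mono:
  assumes "I \<subseteq> J"
  shows "ideal_pow I s \<subseteq> ideal_pow J s"
proof (induction s)
  case (Suc s)
  have "{a * b | a b. a \<in> I \<and> b \<in> ideal_pow I s} \<subseteq> {a * b | a b. a \<in> J \<and> b \<in> ideal_pow J s}"
    using assms Suc by blast
  then show ?case
    unfolding ideal_pow.simps by (rule ideal_gen_mono)
qed simp

lemma kill_vars_ideal_gen:
  assumes "kill_vars W ` A \<subseteq> ideal_gen B"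
  shows "kill_vars W ` ideal_gen A \<subseteq> ideal_gen B"
proof -
  have "ideal.subspace {p. kill_vars W p \<in> ideal_gen B}"
    unfolding ideal_gen_def
    by (rule ideal.subspaceI)
      (simp_all add: kill_vars_add kill_vars_mult ideal.span_zero ideal.span_add ideal.span_scale)
  moreover have "A \<subseteq> {p. kill_vars W p \<in> ideal_gen B}"
    using assms by blast
  ultimately have "ideal_gen A \<subseteq> {p. kill_vars W p \<in> ideal_gen B}"
    by (intro ideal_gen_minimal)
  then show ?thesis by blast
qed

lemma kill_vars_ideal_pow:
  assumes "kill_vars W ` I \<subseteq> J"
  shows "kill_vars W ` ideal_pow I s \<subseteq> ideal_pow J s"
proof (induction s)
  case (Suc s)
  show ?case
    unfolding ideal_pow.simps
  proof (rule kill_vars_ideal_gen, rule image_subsetI)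
    fix p assume "p \<in> {a * b | a b. a \<in> I \<and> b \<in> ideal_pow I s}"
    then obtain a b where "p = a * b" "a \<in> I" "b \<in> ideal_pow I s" by blast
    moreover from this have "kill_vars W a \<in> J" "kill_vars W b \<in> ideal_pow J s"
      using assms Suc by auto
    ultimately have "kill_vars W p \<in> {a * b | a b. a \<in> J \<and> b \<in> ideal_pow J s}"
      unfolding \<open>p = a * b\<close> kill_vars_mult by blast
    then show "kill_vars W p \<in> ideal_gen {a * b | a b. a \<in> J \<and> b \<in> ideal_pow J s}"
      using ideal_gen_base by fast
  qed
qed simp

lemma kill_vars_lss_generator:
  "kill_vars (U \<times> UNIV) (\<Sum>l\<in>UNIV. pvar (i, l) * pvar (j, l))
     = (if i \<in> U \<and> j \<in> U then (\<Sum>l\<in>UNIV. pvar (i, l) * pvar (j, l)) else 0)"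
  by (auto simp: kill_vars_sum kill_vars_mult kill_vars_pvar intro: sum.neutral)

lemma homogeneous_lss_generator:
  "homogeneous 2 (\<Sum>l\<in>UNIV. pvar (i, l) * pvar (j, l) :: ('n \<times> 'd::finite, 'k::comm_ring_1) mpol)"
proof -
  have var: "homogeneous 1 (pvar v :: ('n \<times> 'd, 'k) mpol)" for v
    by (simp add: homogeneous_def pvar_def mdeg_def)
  have "homogeneous 2 (pvar (i, l) * pvar (j, l) :: ('n \<times> 'd, 'k) mpol)" for l
    using homogeneous_mult[OF var var] by (metis one_add_one)
  then show ?thesis
    unfolding homogeneous_def by (auto dest!: keys_sum[THEN subsetD])
qed

section \<open>Comparison maps and homotopies\<close>

definition graded_ideal :: "('v, 'k::comm_ring_1) mpol set \<Rightarrow> bool" where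
  "graded_ideal I \<longleftrightarrow> ideal.subspace I \<and> (\<forall>p\<in>I. \<forall>e. pfilter (\<lambda>m. mdeg m = e) p \<in> I)"

text \<open>Picking out a degree commutes with multiplication by a homogeneous generator up to a shift of
  the degree, by \<open>pfilter_mult\<close>.\<close>

lemma graded_ideal_gen:
  fixes A :: "('v, 'k::comm_ring_1) mpol set"
  assumes A: "\<And>a. a \<in> A \<Longrightarrow> \<exists>d. homogeneous d a"
  shows "graded_ideal (ideal_gen A)"
  unfolding graded_ideal_def
proof (intro conjI ballI allI subspace_ideal_gen)
  fix p e assume "p \<in> ideal_gen A"
  then show "pfilter (\<lambda>m. mdeg m = e) p \<in> ideal_gen A"
    unfolding ideal_gen_def
  proof (induction rule: ideal.span_induct_alt)
    case base
    then show ?case by (simp add: ideal.span_zero)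
  next
    case (step c a q)
    obtain d where d: "homogeneous d a" using A[OF step(1)] by blast
    have "pfilter (\<lambda>m. mdeg m = e) (c * a) = pfilter (\<lambda>m. mdeg m + d = e) c * a"
      by (rule pfilter_mult) (use d in \<open>simp add: homogeneous_def mdeg_add\<close>)
    then show ?case
      unfolding pfilter_add using step by (simp add: ideal.span_add ideal.span_scale ideal.span_base)
  qed
qed

context
  fixes I :: "('v, 'k::field) mpol set" and F :: "('v, 'k) free_cplx"
  assumes res: "graded_free_resolution I F"
begin

lemma bdry_hom:
  "b \<in> basis F (Suc i) \<Longrightarrow> bdry F i b \<in> hom_elems (basis F i) (bdeg F i) (bdeg F (Suc i) b)"
  using res unfolding graded_free_resolution_iff by blast

lemma cycles_eq_image: "cycles I F i = slin UNIV (bdry F i) ` free_on (basis F (Suc i))"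
  using res unfolding graded_free_resolution_iff by blast

lemma bdry_cycle:
  assumes "b \<in> basis F (Suc i)"
  shows "bdry F i b \<in> cycles I F i"
  unfolding cycles_eq_image
  by (rule image_eqI[of _ _ "single b 1"]) (simp_all add: slin_single single_free_on assms)

lemma bdry_bdry: "b \<in> basis F (Suc (Suc i)) \<Longrightarrow> slin UNIV (bdry F i) (bdry F (Suc i) b) = 0"
  using bdry_cycle[of b "Suc i"] by (simp add: cycles_def)

text \<open>Exactness in each degree: replace an arbitrary preimage by its part of the right degree.\<close>

lemma hom_cycle_lift:
  assumes "z \<in> cycles I F i" "z \<in> hom_elems (basis F i) (bdeg F i) e"
  shows "\<exists>y\<in>hom_elems (basis F (Suc i)) (bdeg F (Suc i)) e. slin UNIV (bdry F i) y = z"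
proof -
  obtain x where x: "x \<in> free_on (basis F (Suc i))" "z = slin UNIV (bdry F i) x"
    using assms(1) unfolding cycles_eq_image by blast
  have "slin UNIV (bdry F i) (hom_part (bdeg F (Suc i)) e x) = hom_part (bdeg F i) e z"
    unfolding x(2) by (rule hom_part_slin[symmetric, OF x(1)]) (rule bdry_hom)
  also have "\<dots> = z" by (rule hom_part_id[OF assms(2)])
  finally show ?thesis
    using hom_part_in_hom_elems[OF x(1)] by blast
qed

lemma hom_augm_lift:
  assumes I: "graded_ideal I" and p: "homogeneous e p"
  shows "\<exists>y\<in>hom_elems (basis F 0) (bdeg F 0) e. augm_map F y - p \<in> I"
proof -
  obtain x where x: "x \<in> free_on (basis F 0)" "augm_map F x - p \<in> I"
    using res unfolding graded_free_resolution_iff by blast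
  have hom: "homogeneous (bdeg F 0 b) (augm F b)" if "b \<in> keys x" for b
    using res x(1) that unfolding graded_free_resolution_iff free_on_def by blast
  have "pfilter (\<lambda>m. mdeg m = e) (augm_map F x) = augm_map F (hom_part (bdeg F 0) e x)"
    unfolding augm_map_def
  proof (rule lin_ext_natural)
    fix b assume b: "b \<in> keys x"
    show "pfilter (\<lambda>m. mdeg m = e) (lookup x b * augm F b)
        = lookup (hom_part (bdeg F 0) e x) b * augm F b"
      unfolding lookup_hom_part
      by (rule pfilter_mult) (use hom[OF b] in \<open>simp add: homogeneous_def mdeg_add\<close>)
  qed (simp_all add: pfilter_add keys_hom_part)
  moreover have "pfilter (\<lambda>m. mdeg m = e) p = p"
    by (rule pfilter_id) (use p in \<open>simp add: homogeneous_def\<close>)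
  moreover have "pfilter (\<lambda>m. mdeg m = e) (augm_map F x - p)
      = pfilter (\<lambda>m. mdeg m = e) (augm_map F x) - pfilter (\<lambda>m. mdeg m = e) p"
    by (rule poly_mapping_eqI) (simp add: lookup_pfilter lookup_minus)
  moreover have "pfilter (\<lambda>m. mdeg m = e) (augm_map F x - p) \<in> I"
    using I x(2) by (simp add: graded_ideal_def)
  ultimately have "augm_map F (hom_part (bdeg F 0) e x) - p \<in> I" by simp
  then show ?thesis
    using hom_part_in_hom_elems[OF x(1)] by blast
qed

end

lemma augm_slin:
  assumes J: "ideal.subspace J"
    and a: "\<And>b. b \<in> keys x \<Longrightarrow> augm_map G (a b) - kill_vars W (augm F b) \<in> J"
  shows "augm_map G (slin W a x) - kill_vars W (augm_map F x) \<in> J"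
proof -
  have add: "augm_map G (u + v) = augm_map G u + augm_map G v" for u v
    unfolding augm_map_def by (rule lin_ext_add) (simp_all add: distrib_right)
  have scale: "augm_map G (fscale c u) = c * augm_map G u" for c u
  proof -
    have "keys (fscale c u) \<subseteq> keys u"
      unfolding fscale_def by (rule keys_map_subset)
    then have "augm_map G (fscale c u) = (\<Sum>b\<in>keys u. lookup (fscale c u) b * augm G b)"
      unfolding augm_map_def by (intro lin_ext_superset) simp_all
    also have "\<dots> = c * augm_map G u"
      unfolding augm_map_def lin_ext_def by (simp only: lookup_fscale mult.assoc sum_distrib_left)
    finally show ?thesis .
  qed
  have "augm_map G (slin W a x) = lin_ext (\<lambda>c. (*) (kill_vars W c)) (\<lambda>b. augm_map G (a b)) x"
    unfolding slin_def
    by (rule lin_ext_natural) (simp_all add: add scale, simp add: augm_map_def)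
  moreover have "kill_vars W (augm_map F x)
      = lin_ext (\<lambda>c. (*) (kill_vars W c)) (\<lambda>b. kill_vars W (augm F b)) x"
    unfolding augm_map_def by (rule lin_ext_natural) (simp_all add: kill_vars_add kill_vars_mult)
  ultimately have "augm_map G (slin W a x) - kill_vars W (augm_map F x)
      = lin_ext (\<lambda>c. (*) (kill_vars W c)) (\<lambda>b. augm_map G (a b) - kill_vars W (augm F b)) x"
    by (simp add: lin_ext_images_diff right_diff_distrib)
  also have "\<dots> \<in> J"
    unfolding lin_ext_def by (intro ideal.subspace_sum[OF J] ideal.subspace_scale[OF J] a)
  finally show ?thesis .
qed

text \<open>The comparison theorem for a map \<open>S/I \<rightarrow> S/J\<close> induced by \<open>kill_vars W\<close>. Images of basis elements
  are chosen one homological degree after the other; the choice is possible because the maps so far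
  take cycles to cycles, which is the invariant of the recursion.\<close>

lemma comparison_map:
  fixes F G :: "('v, 'k::field) free_cplx"
  assumes F: "graded_free_resolution I F" and G: "graded_free_resolution J G"
    and J: "graded_ideal J" and IJ: "kill_vars W ` I \<subseteq> J"
  shows "\<exists>\<alpha>. (\<forall>i. \<forall>b\<in>basis F i. \<alpha> i b \<in> hom_elems (basis G i) (bdeg G i) (bdeg F i b))
    \<and> (\<forall>b\<in>basis F 0. augm_map G (\<alpha> 0 b) - kill_vars W (augm F b) \<in> J)
    \<and> (\<forall>i. \<forall>b\<in>basis F (Suc i). slin UNIV (bdry G i) (\<alpha> (Suc i) b) = slin W (\<alpha> i) (bdry F i b))"
proof -
  have subJ: "ideal.subspace J" using J by (simp add: graded_ideal_def)
  let ?base = "\<lambda>a. \<forall>b\<in>basis F 0. augm_map G (a b) - kill_vars W (augm F b) \<in> J"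
  let ?P = "\<lambda>n a. (\<forall>b\<in>basis F n. a b \<in> hom_elems (basis G n) (bdeg G n) (bdeg F n b))
    \<and> (\<forall>x\<in>cycles I F n. slin W a x \<in> cycles J G n) \<and> (n = 0 \<longrightarrow> ?base a)"
  let ?Q = "\<lambda>n a a'. \<forall>b\<in>basis F (Suc n). slin UNIV (bdry G n) (a' b) = slin W a (bdry F n b)"
  have free: "slin W a x \<in> free_on (basis G n)"
    if "x \<in> cycles I F n" "\<forall>b\<in>basis F n. a b \<in> hom_elems (basis G n) (bdeg G n) (bdeg F n b)" for a x n
    by (rule slin_mem[OF subspace_free_on], rule hom_elems_free_on)
      (use that in \<open>auto simp: cycles_def free_on_def\<close>)
  have "\<exists>\<alpha>. \<forall>n. ?P n (\<alpha> n) \<and> ?Q n (\<alpha> n) (\<alpha> (Suc n))"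
  proof (rule dependent_nat_choice)
    have "\<exists>y. y \<in> hom_elems (basis G 0) (bdeg G 0) (bdeg F 0 b)
        \<and> augm_map G y - kill_vars W (augm F b) \<in> J" if "b \<in> basis F 0" for b
    proof -
      have "homogeneous (bdeg F 0 b) (augm F b)"
        using F that unfolding graded_free_resolution_iff by blast
      then have "homogeneous (bdeg F 0 b) (kill_vars W (augm F b))"
        by (simp add: homogeneous_def kill_vars_def keys_pfilter)
      from hom_augm_lift[OF G J this] show ?thesis by blast
    qed
    then obtain a where a: "\<And>b. b \<in> basis F 0 \<Longrightarrow> a b \<in> hom_elems (basis G 0) (bdeg G 0) (bdeg F 0 b)"
      "\<And>b. b \<in> basis F 0 \<Longrightarrow> augm_map G (a b) - kill_vars W (augm F b) \<in> J"
      by metis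
    have "slin W a x \<in> cycles J G 0" if x: "x \<in> cycles I F 0" for x
    proof -
      have "augm_map G (slin W a x) - kill_vars W (augm_map F x) \<in> J"
        by (rule augm_slin[OF subJ]) (use a(2) x in \<open>auto simp: cycles_def free_on_def\<close>)
      moreover have "kill_vars W (augm_map F x) \<in> J"
        using x IJ by (auto simp: cycles_def)
      ultimately have "augm_map G (slin W a x) - kill_vars W (augm_map F x)
          + kill_vars W (augm_map F x) \<in> J"
        by (rule ideal.subspace_add[OF subJ])
      then show ?thesis
        using free[OF x, of a] a(1) by (simp add: cycles_def)
    qed
    then show "\<exists>a. ?P 0 a" using a by blast
  next
    fix a n assume P: "?P n a"
    have "\<exists>y. y \<in> hom_elems (basis G (Suc n)) (bdeg G (Suc n)) (bdeg F (Suc n) b)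
        \<and> slin UNIV (bdry G n) y = slin W a (bdry F n b)" if b: "b \<in> basis F (Suc n)" for b
    proof -
      have "slin W a (bdry F n b) \<in> cycles J G n"
        using P bdry_cycle[OF F b] by blast
      moreover have "slin W a (bdry F n b) \<in> hom_elems (basis G n) (bdeg G n) (bdeg F (Suc n) b)"
        by (rule slin_hom_elems[OF bdry_hom[OF F b]]) (use P in blast)
      ultimately show ?thesis
        using hom_cycle_lift[OF G] by blast
    qed
    then obtain a' where a': "\<And>b. b \<in> basis F (Suc n) \<Longrightarrow>
        a' b \<in> hom_elems (basis G (Suc n)) (bdeg G (Suc n)) (bdeg F (Suc n) b)"
      "\<And>b. b \<in> basis F (Suc n) \<Longrightarrow> slin UNIV (bdry G n) (a' b) = slin W a (bdry F n b)"
      by metis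
    have "slin W a' x \<in> cycles J G (Suc n)" if x: "x \<in> cycles I F (Suc n)" for x
    proof -
      have "slin UNIV (bdry G n) (slin W a' x) = slin W (\<lambda>b. slin UNIV (bdry G n) (a' b)) x"
        by (simp add: slin_slin)
      also have "\<dots> = slin W (\<lambda>b. slin W a (bdry F n b)) x"
        by (rule slin_cong) (use a'(2) x in \<open>auto simp: cycles_def free_on_def\<close>)
      also have "\<dots> = slin W a (slin UNIV (bdry F n) x)"
        by (simp add: slin_slin)
      also have "\<dots> = 0"
        using x by (simp add: cycles_def)
      finally show ?thesis
        using free[OF x, of a'] a'(1) by (simp add: cycles_def)
    qed
    then show "\<exists>a'. ?P (Suc n) a' \<and> ?Q n a a'"
      using a' by (intro exI[of _ a']) simp
  qed
  then obtain \<alpha> where \<alpha>: "\<forall>n. ?P n (\<alpha> n) \<and> ?Q n (\<alpha> n) (\<alpha> (Suc n))" ..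
  show ?thesis
    by (rule exI[of _ \<alpha>], intro conjI allI) (use \<alpha> in \<open>blast+\<close>)
qed

text \<open>A semilinear chain map over the zero map \<open>S/I \<rightarrow> S/J\<close> is null-homotopic. The recursion maintains
  that \<open>\<partial> h = \<theta>\<close> on cycles: then \<open>\<theta> - h \<partial>\<close> sends the next basis elements to cycles, which lift.\<close>

lemma null_homotopy:
  fixes F G :: "('v, 'k::field) free_cplx"
  assumes F: "graded_free_resolution I F" and G: "graded_free_resolution J G"
    and hom: "\<And>i b. b \<in> basis F i \<Longrightarrow> \<theta> i b \<in> hom_elems (basis G i) (bdeg G i) (bdeg F i b)"
    and augm: "\<And>b. b \<in> basis F 0 \<Longrightarrow> augm_map G (\<theta> 0 b) \<in> J"
    and chain: "\<And>i b. b \<in> basis F (Suc i) \<Longrightarrow>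
      slin UNIV (bdry G i) (\<theta> (Suc i) b) = slin W (\<theta> i) (bdry F i b)"
  shows "\<exists>h. (\<forall>i. \<forall>b\<in>basis F i. h i b \<in> hom_elems (basis G (Suc i)) (bdeg G (Suc i)) (bdeg F i b))
    \<and> (\<forall>b\<in>basis F 0. slin UNIV (bdry G 0) (h 0 b) = \<theta> 0 b)
    \<and> (\<forall>i. \<forall>b\<in>basis F (Suc i). slin UNIV (bdry G (Suc i)) (h (Suc i) b)
          = \<theta> (Suc i) b - slin W (h i) (bdry F i b))"
proof -
  let ?base = "\<lambda>h. \<forall>b\<in>basis F 0. slin UNIV (bdry G 0) (h b) = \<theta> 0 b"
  let ?P = "\<lambda>n h. (\<forall>b\<in>basis F n. h b \<in> hom_elems (basis G (Suc n)) (bdeg G (Suc n)) (bdeg F n b))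
    \<and> (\<forall>x\<in>cycles I F n. slin UNIV (bdry G n) (slin W h x) = slin W (\<theta> n) x) \<and> (n = 0 \<longrightarrow> ?base h)"
  let ?Q = "\<lambda>n h h'. \<forall>b\<in>basis F (Suc n). slin UNIV (bdry G (Suc n)) (h' b)
    = \<theta> (Suc n) b - slin W h (bdry F n b)"
  have "\<exists>h. \<forall>n. ?P n (h n) \<and> ?Q n (h n) (h (Suc n))"
  proof (rule dependent_nat_choice)
    have "\<exists>y. y \<in> hom_elems (basis G (Suc 0)) (bdeg G (Suc 0)) (bdeg F 0 b)
        \<and> slin UNIV (bdry G 0) y = \<theta> 0 b" if b: "b \<in> basis F 0" for b
    proof -
      have "\<theta> 0 b \<in> cycles J G 0"
        using hom[OF b] augm[OF b] by (simp add: cycles_def hom_elems_free_on)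
      then show ?thesis
        using hom_cycle_lift[OF G _ hom[OF b]] by blast
    qed
    then obtain h where h: "\<And>b. b \<in> basis F 0 \<Longrightarrow>
        h b \<in> hom_elems (basis G (Suc 0)) (bdeg G (Suc 0)) (bdeg F 0 b)"
      "\<And>b. b \<in> basis F 0 \<Longrightarrow> slin UNIV (bdry G 0) (h b) = \<theta> 0 b" by metis
    have "slin UNIV (bdry G 0) (slin W h x) = slin W (\<theta> 0) x" if x: "x \<in> cycles I F 0" for x
    proof -
      have "slin UNIV (bdry G 0) (slin W h x) = slin W (\<lambda>b. slin UNIV (bdry G 0) (h b)) x"
        by (simp add: slin_slin)
      also have "\<dots> = slin W (\<theta> 0) x"
        by (rule slin_cong) (use h(2) x in \<open>auto simp: cycles_def free_on_def\<close>)
      finally show ?thesis .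
    qed
    then show "\<exists>h. ?P 0 h" using h by (intro exI[of _ h]) simp
  next
    fix h n assume P: "?P n h"
    have "\<exists>y. y \<in> hom_elems (basis G (Suc (Suc n))) (bdeg G (Suc (Suc n))) (bdeg F (Suc n) b)
        \<and> slin UNIV (bdry G (Suc n)) y = \<theta> (Suc n) b - slin W h (bdry F n b)"
      if b: "b \<in> basis F (Suc n)" for b
    proof -
      have mem: "slin W h (bdry F n b) \<in> hom_elems (basis G (Suc n)) (bdeg G (Suc n)) (bdeg F (Suc n) b)"
        by (rule slin_hom_elems[OF bdry_hom[OF F b]]) (use P in blast)
      have mem: "\<theta> (Suc n) b - slin W h (bdry F n b)
          \<in> hom_elems (basis G (Suc n)) (bdeg G (Suc n)) (bdeg F (Suc n) b)"
        by (rule hom_elems_diff[OF hom[OF b] mem])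
      have "slin UNIV (bdry G n) (slin W h (bdry F n b)) = slin W (\<theta> n) (bdry F n b)"
        using P bdry_cycle[OF F b] by blast
      then have "slin UNIV (bdry G n) (\<theta> (Suc n) b - slin W h (bdry F n b)) = 0"
        by (simp add: slin_diff chain[OF b])
      then have "\<theta> (Suc n) b - slin W h (bdry F n b) \<in> cycles J G (Suc n)"
        using hom_elems_free_on[OF mem] by (simp add: cycles_def)
      then show ?thesis
        using hom_cycle_lift[OF G _ mem] by blast
    qed
    then obtain h' where h': "\<And>b. b \<in> basis F (Suc n) \<Longrightarrow>
        h' b \<in> hom_elems (basis G (Suc (Suc n))) (bdeg G (Suc (Suc n))) (bdeg F (Suc n) b)"
      "\<And>b. b \<in> basis F (Suc n) \<Longrightarrow>
        slin UNIV (bdry G (Suc n)) (h' b) = \<theta> (Suc n) b - slin W h (bdry F n b)" by metis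
    have "slin UNIV (bdry G (Suc n)) (slin W h' x) = slin W (\<theta> (Suc n)) x"
      if x: "x \<in> cycles I F (Suc n)" for x
    proof -
      have "slin UNIV (bdry G (Suc n)) (slin W h' x) = slin W (\<lambda>b. slin UNIV (bdry G (Suc n)) (h' b)) x"
        by (simp add: slin_slin)
      also have "\<dots> = slin W (\<lambda>b. \<theta> (Suc n) b - slin W h (bdry F n b)) x"
        by (rule slin_cong) (use h'(2) x in \<open>auto simp: cycles_def free_on_def\<close>)
      also have "\<dots> = slin W (\<theta> (Suc n)) x - slin W h (slin UNIV (bdry F n) x)"
        by (simp add: slin_images_diff slin_slin)
      also have "\<dots> = slin W (\<theta> (Suc n)) x"
        using x by (simp add: cycles_def)
      finally show ?thesis .
    qed
    then show "\<exists>h'. ?P (Suc n) h' \<and> ?Q n h h'"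
      using h' by (intro exI[of _ h']) simp
  qed
  then obtain h where h: "\<forall>n. ?P n (h n) \<and> ?Q n (h n) (h (Suc n))" ..
  show ?thesis
    by (rule exI[of _ h], intro conjI allI) (use h in \<open>blast+\<close>)
qed

section \<open>Tor as a functor of resolutions\<close>

text \<open>The dimension inequality for a map \<open>V'/B' \<rightarrow> V/B\<close> that is onto. A basis of \<open>B'\<close> is extended to one of
  \<open>V'\<close>; the images of the new basis vectors, together with a basis of \<open>B\<close>, span \<open>V\<close>.\<close>

lemma dim_quotient_le:
  assumes lin: "Vector_Spaces.linear s2 s1 g"
    and B: "B \<subseteq> module.span s1 E" "finite E"
    and V': "V' \<subseteq> module.span s2 E'" "finite E'"
    and B': "B' \<subseteq> V'" "g ` B' \<subseteq> B"
    and surj: "\<And>v. v \<in> V \<Longrightarrow> \<exists>v'\<in>V'. v - g v' \<in> B"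
  shows "vector_space.dim s1 V - vector_space.dim s1 B \<le> vector_space.dim s2 V' - vector_space.dim s2 B'"
proof -
  interpret g: Vector_Spaces.linear s2 s1 g by (rule lin)
  obtain X where X: "X \<subseteq> B" "g.vs2.independent X" "B \<subseteq> g.vs2.span X" "card X = g.vs2.dim B"
    by (rule g.vs2.basis_exists)
  obtain Y where Y: "Y \<subseteq> B'" "g.vs1.independent Y" "B' \<subseteq> g.vs1.span Y" "card Y = g.vs1.dim B'"
    by (rule g.vs1.basis_exists)
  obtain Z where Z: "Y \<subseteq> Z" "Z \<subseteq> V'" "g.vs1.independent Z" "V' \<subseteq> g.vs1.span Z"
    using g.vs1.maximal_independent_subset_extend[of Y V'] Y B' by blast
  have finX: "finite X"
    using g.vs2.independent_span_bound[OF B(2) X(2)] X(1) B(1) by blast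
  have finZ: "finite Z"
    using g.vs1.independent_span_bound[OF V'(2) Z(3)] Z(2) V'(1) by blast
  let ?S = "X \<union> g ` (Z - Y)"
  have gZ: "g ` Z \<subseteq> g.vs2.span ?S"
  proof
    fix u assume "u \<in> g ` Z"
    then obtain z where z: "z \<in> Z" "u = g z" by blast
    show "u \<in> g.vs2.span ?S"
    proof (cases "z \<in> Y")
      case True
      then have "u \<in> B" using z Y(1) B'(2) by blast
      moreover have "g.vs2.span X \<subseteq> g.vs2.span ?S" by (rule g.vs2.span_mono) blast
      ultimately show ?thesis using X(3) by blast
    next
      case False
      then show ?thesis using z by (intro g.vs2.span_base) blast
    qed
  qed
  have "V \<subseteq> g.vs2.span ?S"
  proof
    fix v assume "v \<in> V"
    then obtain v' where v': "v' \<in> V'" "v - g v' \<in> B" using surj by blast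
    have "g v' \<in> g ` g.vs1.span Z" using v'(1) Z(4) by blast
    also have "g ` g.vs1.span Z = g.vs2.span (g ` Z)" by (rule g.span_image[symmetric])
    also have "\<dots> \<subseteq> g.vs2.span ?S"
      by (rule g.vs2.span_minimal[OF gZ g.vs2.subspace_span])
    finally have "g v' \<in> g.vs2.span ?S" .
    moreover have "v - g v' \<in> g.vs2.span ?S"
      using v'(2) X(3) g.vs2.span_mono[of X ?S] by blast
    ultimately have "(v - g v') + g v' \<in> g.vs2.span ?S"
      by (intro g.vs2.span_add)
    then show "v \<in> g.vs2.span ?S" by simp
  qed
  then have "g.vs2.dim V \<le> card ?S"
    by (rule g.vs2.dim_le_card) (use finX finZ in simp)
  also have "\<dots> \<le> card X + card (g ` (Z - Y))" by (rule card_Un_le)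
  also have "card (g ` (Z - Y)) \<le> card (Z - Y)" using finZ by (intro card_image_le) simp
  also have "card (Z - Y) = card Z - card Y"
    using Z(1) finZ by (intro card_Diff_subset) (auto intro: finite_subset)
  also have "card Z = g.vs1.dim V'"
    by (rule g.vs1.basis_card_eq_dim[OF Z(2,4,3)])
  finally show ?thesis using X(4) Y(4) by simp
qed

text \<open>The map \<open>f \<otimes> k\<close>, for \<open>f\<close> given by its values on a basis. Semilinear and linear maps with the same
  values give the same map, as killing variables does not affect constant terms.\<close>

definition tensor_lin ::
  "(nat \<Rightarrow> (nat \<Rightarrow>\<^sub>0 ('v, 'k) mpol)) \<Rightarrow> (nat \<Rightarrow>\<^sub>0 'k::field) \<Rightarrow> (nat \<Rightarrow>\<^sub>0 'k)" where
  "tensor_lin f = lin_ext fscale (\<lambda>b. Poly_Mapping.map const_term (f b))"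

lemma tensor_map_eq: "tensor_map F i = tensor_lin (bdry F i)"
  by (simp add: tensor_map_def tensor_lin_def)

lemma tensor_lin_add: "tensor_lin f (x + y) = tensor_lin f x + tensor_lin f y"
  unfolding tensor_lin_def by (rule lin_ext_add) (simp_all add: free.scale_left_distrib)

lemma tensor_lin_scale: "tensor_lin f (fscale c x) = fscale c (tensor_lin f x)"
proof -
  have "keys (fscale c x) \<subseteq> keys x"
    unfolding fscale_def by (rule keys_map_subset)
  then have "tensor_lin f (fscale c x)
      = (\<Sum>b\<in>keys x. fscale (lookup (fscale c x) b) (Poly_Mapping.map const_term (f b)))"
    unfolding tensor_lin_def by (intro lin_ext_superset) simp_all
  also have "\<dots> = fscale c (tensor_lin f x)"
    unfolding tensor_lin_def lin_ext_def free.scale_sum_right by (simp add: lookup_fscale)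
  finally show ?thesis .
qed

lemma linear_tensor_lin:
  fixes f :: "nat \<Rightarrow> (nat \<Rightarrow>\<^sub>0 ('v, 'k::field) mpol)"
  shows "Vector_Spaces.linear fscale fscale (tensor_lin f)"
proof -
  interpret vector_space "fscale :: 'k \<Rightarrow> _" by (rule vector_space_fscale)
  show ?thesis by unfold_locales (simp_all add: tensor_lin_add tensor_lin_scale)
qed

lemma tensor_lin_zero [simp]: "tensor_lin f 0 = 0"
  by (simp add: tensor_lin_def)

lemma tensor_lin_single_one: "tensor_lin (\<lambda>b. single b 1 :: nat \<Rightarrow>\<^sub>0 ('v, 'k::field) mpol) x = x"
proof -
  have "Poly_Mapping.map const_term (single c (1 :: ('v, 'k) mpol)) = single c 1" for c :: nat
    by (rule poly_mapping_eqI) (simp add: lookup_map_zero const_term_def lookup_single when_def)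
  then show ?thesis
    by (simp add: tensor_lin_def lin_ext_fscale_single)
qed

lemma map_const_term_diff:
  fixes x y :: "nat \<Rightarrow>\<^sub>0 ('v, 'k::field) mpol"
  shows "Poly_Mapping.map const_term (x - y) = Poly_Mapping.map const_term x - Poly_Mapping.map const_term y"
  by (rule poly_mapping_eqI) (simp add: lookup_map_zero const_term_def lookup_minus)

lemma tensor_lin_images_diff: "tensor_lin (\<lambda>b. f b - g b) x = tensor_lin f x - tensor_lin g x"
  unfolding tensor_lin_def map_const_term_diff
  by (rule lin_ext_images_diff) (simp add: free.scale_right_diff_distrib)

lemma tensor_lin_cong: "(\<And>b. b \<in> keys x \<Longrightarrow> f b = g b) \<Longrightarrow> tensor_lin f x = tensor_lin g x"
  unfolding tensor_lin_def by (rule lin_ext_cong) simp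

lemma map_const_term_slin:
  fixes g :: "nat \<Rightarrow> (nat \<Rightarrow>\<^sub>0 ('v, 'k::field) mpol)"
  shows "Poly_Mapping.map const_term (slin W g y) = tensor_lin g (Poly_Mapping.map const_term y)"
  unfolding slin_def tensor_lin_def
proof (rule lin_ext_natural)
  fix b
  show "Poly_Mapping.map const_term (fscale (kill_vars W (lookup y b)) (g b))
      = fscale (lookup (Poly_Mapping.map const_term y) b) (Poly_Mapping.map const_term (g b))"
  proof (rule poly_mapping_eqI)
    fix c
    have zero: "const_term 0 = 0" by (simp add: const_term_def)
    show "lookup (Poly_Mapping.map const_term (fscale (kill_vars W (lookup y b)) (g b))) c
      = lookup (fscale (lookup (Poly_Mapping.map const_term y) b) (Poly_Mapping.map const_term (g b))) c"
      by (simp add: lookup_map_zero zero lookup_fscale const_term_mult const_term_kill_vars)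
  qed
next
  fix m n :: "nat \<Rightarrow>\<^sub>0 ('v, 'k) mpol"
  show "Poly_Mapping.map const_term (m + n) = Poly_Mapping.map const_term m + Poly_Mapping.map const_term n"
    by (rule poly_mapping_eqI) (simp add: lookup_map_zero const_term_def lookup_add)
qed (simp_all add: keys_map_subset)

lemma tensor_lin_comp: "tensor_lin g (tensor_lin f x) = tensor_lin (\<lambda>b. slin W g (f b)) x"
  unfolding tensor_lin_def[of f] tensor_lin_def[of "\<lambda>b. slin W g (f b)"]
  by (rule lin_ext_natural)
    (simp_all add: tensor_lin_add tensor_lin_scale map_const_term_slin)

text \<open>Only monomials of degree 0 survive the reduction to \<open>k\<close>, so degrees of basis elements are
  preserved on the nose.\<close>

lemma tensor_lin_degree:
  assumes x: "x \<in> free_on {b \<in> B. D b = j}"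
    and f: "\<And>b. b \<in> B \<Longrightarrow> f b \<in> hom_elems B' D' (D b)"
  shows "tensor_lin f x \<in> free_on {b \<in> B'. D' b = j}"
  unfolding tensor_lin_def
proof (rule lin_ext_fscale_mem[where h = "\<lambda>c. c", OF subspace_free_on])
  fix b assume "b \<in> keys x"
  then have b: "b \<in> B" "D b = j" using x by (auto simp: free_on_def)
  show "Poly_Mapping.map const_term (f b) \<in> free_on {b \<in> B'. D' b = j}"
  proof -
    have "c \<in> B' \<and> D' c = j" if c: "c \<in> keys (Poly_Mapping.map const_term (f b))" for c
    proof -
      have "lookup (lookup (f b) c) 0 \<noteq> 0"
        using c by (simp add: in_keys_iff lookup_map_zero const_term_def)
      then have "0 \<in> keys (lookup (f b) c)" by (simp add: in_keys_iff)
      moreover have "c \<in> keys (f b)"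
        using keys_map_subset c by (rule subsetD)
      ultimately show ?thesis
        using f[OF b(1)] b(2) by (force simp: hom_elems_def free_on_def)
    qed
    then show ?thesis by (auto simp: free_on_def)
  qed
qed

lemma tensor_comp_finite_dim:
  assumes "graded_free_resolution I F"
  shows "\<exists>E. finite E \<and> tensor_comp F i j \<subseteq> module.span fscale E"
proof (intro exI conjI)
  let ?E = "(\<lambda>b. single b 1) ` {b \<in> basis F i. bdeg F i b = j}"
  show "finite ?E"
    using assms unfolding graded_free_resolution_iff by blast
  show "tensor_comp F i j \<subseteq> free.span ?E"
  proof
    fix x assume "x \<in> tensor_comp F i j"
    moreover have "x = lin_ext fscale (\<lambda>b. single b 1) x"
      using lin_ext_fscale_single[of x] by simp
    ultimately show "x \<in> free.span ?E"
      unfolding tensor_comp_def lin_ext_image_span[symmetric] by blast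
  qed
qed

lemma tor_boundaries_subset_cycles:
  fixes F :: "('v, 'k::field) free_cplx"
  assumes F: "graded_free_resolution I F"
  shows "tor_boundaries F i j \<subseteq> tor_cycles F i j"
proof
  fix y assume "y \<in> tor_boundaries F i j"
  then obtain x where x: "x \<in> tensor_comp F (Suc i) j" "y = tensor_lin (bdry F i) x"
    by (auto simp: tor_boundaries_def tensor_map_eq)
  have y: "y \<in> tensor_comp F i j"
    using x(1) unfolding x(2) tensor_comp_def by (rule tensor_lin_degree) (rule bdry_hom[OF F])
  show "y \<in> tor_cycles F i j"
  proof (cases i)
    case 0
    then show ?thesis using y by (simp add: tor_cycles_def)
  next
    case (Suc i')
    have "tensor_lin (bdry F i') y = tensor_lin (\<lambda>b. slin UNIV (bdry F i') (bdry F i b)) x"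
      unfolding x(2) by (rule tensor_lin_comp)
    also have "\<dots> = tensor_lin (\<lambda>b. 0 :: nat \<Rightarrow>\<^sub>0 ('v, 'k) mpol) x"
      by (rule tensor_lin_cong)
        (use x(1) bdry_bdry[OF F] in \<open>auto simp: Suc tensor_comp_def free_on_def\<close>)
    also have "\<dots> = 0"
      by (simp add: tensor_lin_def lin_ext_def)
    finally show ?thesis using y Suc by (simp add: tor_cycles_def tensor_map_eq)
  qed
qed

lemma tor_cycles_subset: "tor_cycles F i j \<subseteq> tensor_comp F i j"
  by (auto simp: tor_cycles_def split: nat.splits)

lemma tensor_chain_map:
  assumes hom: "\<And>i b. b \<in> basis F i \<Longrightarrow> \<alpha> i b \<in> hom_elems (basis G i) (bdeg G i) (bdeg F i b)"
    and chain: "\<And>i b. b \<in> basis F (Suc i) \<Longrightarrow>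
      slin UNIV (bdry G i) (\<alpha> (Suc i) b) = slin W (\<alpha> i) (bdry F i b)"
  shows "x \<in> tensor_comp F i j \<Longrightarrow> tensor_lin (\<alpha> i) x \<in> tensor_comp G i j"
    and "x \<in> tensor_comp F (Suc i) j \<Longrightarrow>
      tensor_lin (bdry G i) (tensor_lin (\<alpha> (Suc i)) x) = tensor_lin (\<alpha> i) (tensor_lin (bdry F i) x)"
proof -
  show "tensor_lin (\<alpha> i) x \<in> tensor_comp G i j" if "x \<in> tensor_comp F i j"
    using that unfolding tensor_comp_def by (rule tensor_lin_degree) (rule hom)
  assume x: "x \<in> tensor_comp F (Suc i) j"
  have "tensor_lin (bdry G i) (tensor_lin (\<alpha> (Suc i)) x)
      = tensor_lin (\<lambda>b. slin UNIV (bdry G i) (\<alpha> (Suc i) b)) x"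
    by (rule tensor_lin_comp)
  also have "\<dots> = tensor_lin (\<lambda>b. slin W (\<alpha> i) (bdry F i b)) x"
    by (rule tensor_lin_cong) (use x chain in \<open>auto simp: tensor_comp_def free_on_def\<close>)
  also have "\<dots> = tensor_lin (\<alpha> i) (tensor_lin (bdry F i) x)"
    by (rule tensor_lin_comp[symmetric])
  finally show "tensor_lin (bdry G i) (tensor_lin (\<alpha> (Suc i)) x)
      = tensor_lin (\<alpha> i) (tensor_lin (bdry F i) x)" .
qed

text \<open>The maps \<open>\<alpha> : F \<rightarrow> G\<close> over \<open>S/I \<rightarrow> S/J\<close> and \<open>\<beta> : G \<rightarrow> F\<close> over \<open>kill_vars W : S/J \<rightarrow> S/I\<close> exist by
  \<open>comparison_map\<close>. As the matrices of \<open>F\<close> have entries in \<open>k[W]\<close>, the semilinear map fixing the basis of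
  \<open>F\<close> is a chain map, and \<open>\<theta> = \<beta> \<alpha> - 1\<close> on basis elements extends to a semilinear chain map over zero.
  Its null-homotopy shows that \<open>\<beta> \<alpha>\<close> is the identity on homology after tensoring with \<open>k\<close>, so \<open>\<beta>\<close> is
  onto there.\<close>

lemma tor_dim_retract:
  fixes F G :: "('v, 'k::field) free_cplx"
  assumes F: "graded_free_resolution I F" and G: "graded_free_resolution J G"
    and I: "graded_ideal I" and J: "graded_ideal J"
    and IJ: "I \<subseteq> J" and JI: "kill_vars W ` J \<subseteq> I"
    and bdryW: "\<And>i b. b \<in> basis F (Suc i) \<Longrightarrow> vars_in W (bdry F i b)"
    and augmW: "\<And>b. b \<in> basis F 0 \<Longrightarrow> kill_vars W (augm F b) = augm F b"
  shows "tor_dim F i j \<le> tor_dim G i j"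
proof -
  have subI: "ideal.subspace I" using I by (simp add: graded_ideal_def)
  have "kill_vars UNIV ` I \<subseteq> J" using IJ by simp
  from comparison_map[OF F G J this] obtain \<alpha> where
    \<alpha>: "\<And>i b. b \<in> basis F i \<Longrightarrow> \<alpha> i b \<in> hom_elems (basis G i) (bdeg G i) (bdeg F i b)"
      "\<And>b. b \<in> basis F 0 \<Longrightarrow> augm_map G (\<alpha> 0 b) - kill_vars UNIV (augm F b) \<in> J"
      "\<And>i b. b \<in> basis F (Suc i) \<Longrightarrow> slin UNIV (bdry G i) (\<alpha> (Suc i) b) = slin UNIV (\<alpha> i) (bdry F i b)"
    by metis
  from comparison_map[OF G F I JI] obtain \<beta> where
    \<beta>: "\<And>i b. b \<in> basis G i \<Longrightarrow> \<beta> i b \<in> hom_elems (basis F i) (bdeg F i) (bdeg G i b)"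
      "\<And>b. b \<in> basis G 0 \<Longrightarrow> augm_map F (\<beta> 0 b) - kill_vars W (augm G b) \<in> I"
      "\<And>i b. b \<in> basis G (Suc i) \<Longrightarrow> slin UNIV (bdry F i) (\<beta> (Suc i) b) = slin W (\<beta> i) (bdry G i b)"
    by metis
  define \<theta> where "\<theta> i b = slin W (\<beta> i) (\<alpha> i b) - single b 1" for i b
  have \<theta>hom: "\<theta> i b \<in> hom_elems (basis F i) (bdeg F i) (bdeg F i b)" if "b \<in> basis F i" for i b
    unfolding \<theta>_def
    by (rule hom_elems_diff[OF slin_hom_elems[OF \<alpha>(1)[OF that] \<beta>(1)] hom_elems_single[OF that]])
  have \<theta>augm: "augm_map F (\<theta> 0 b) \<in> I" if b: "b \<in> basis F 0" for b
  proof -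
    have "augm_map F (slin W (\<beta> 0) (\<alpha> 0 b)) - kill_vars W (augm_map G (\<alpha> 0 b)) \<in> I"
      by (rule augm_slin[OF subI])
        (use \<beta>(2) hom_elems_free_on[OF \<alpha>(1)[OF b]] in \<open>auto simp: free_on_def\<close>)
    moreover have "kill_vars W (augm_map G (\<alpha> 0 b) - augm F b) \<in> I"
      using \<alpha>(2)[OF b] JI by auto
    then have "kill_vars W (augm_map G (\<alpha> 0 b)) - augm F b \<in> I"
      by (simp add: kill_vars_diff augmW[OF b])
    ultimately have "(augm_map F (slin W (\<beta> 0) (\<alpha> 0 b)) - kill_vars W (augm_map G (\<alpha> 0 b)))
        + (kill_vars W (augm_map G (\<alpha> 0 b)) - augm F b) \<in> I"
      by (rule ideal.subspace_add[OF subI])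
    moreover have "augm_map F (u - v) = augm_map F u - augm_map F v" for u v
    proof -
      have "augm_map F ((u - v) + v) = augm_map F (u - v) + augm_map F v"
        unfolding augm_map_def by (rule lin_ext_add) (simp_all add: distrib_right)
      then show ?thesis by simp
    qed
    moreover have "augm_map F (single b 1) = augm F b"
      unfolding augm_map_def by (simp add: lin_ext_single)
    ultimately show ?thesis by (simp add: \<theta>_def)
  qed
  have \<theta>chain: "slin UNIV (bdry F i) (\<theta> (Suc i) b) = slin W (\<theta> i) (bdry F i b)"
    if b: "b \<in> basis F (Suc i)" for i b
  proof -
    have "slin UNIV (bdry F i) (slin W (\<beta> (Suc i)) (\<alpha> (Suc i) b))
        = slin W (\<lambda>c. slin UNIV (bdry F i) (\<beta> (Suc i) c)) (\<alpha> (Suc i) b)"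
      by (simp add: slin_slin)
    also have "\<dots> = slin W (\<lambda>c. slin W (\<beta> i) (bdry G i c)) (\<alpha> (Suc i) b)"
      by (rule slin_cong)
        (use \<beta>(3) hom_elems_free_on[OF \<alpha>(1)[OF b]] in \<open>auto simp: free_on_def\<close>)
    also have "\<dots> = slin W (\<beta> i) (slin UNIV (bdry G i) (\<alpha> (Suc i) b))"
      by (simp add: slin_slin)
    also have "\<dots> = slin W (\<lambda>c. slin W (\<beta> i) (\<alpha> i c)) (bdry F i b)"
      by (simp add: \<alpha>(3)[OF b] slin_slin)
    finally show ?thesis
      unfolding \<theta>_def slin_diff slin_images_diff
      by (simp add: slin_single slin_single_vars_in[OF bdryW[OF b]])
  qed
  from null_homotopy[where \<theta> = \<theta>, OF F F \<theta>hom \<theta>augm \<theta>chain] obtain h where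
    h: "\<And>i b. b \<in> basis F i \<Longrightarrow> h i b \<in> hom_elems (basis F (Suc i)) (bdeg F (Suc i)) (bdeg F i b)"
      "\<And>b. b \<in> basis F 0 \<Longrightarrow> slin UNIV (bdry F 0) (h 0 b) = \<theta> 0 b"
      "\<And>i b. b \<in> basis F (Suc i) \<Longrightarrow> slin UNIV (bdry F (Suc i)) (h (Suc i) b)
          = \<theta> (Suc i) b - slin W (h i) (bdry F i b)"
    by metis
  have bound: "tensor_lin (\<theta> i) x = tensor_lin (bdry F i) (tensor_lin (h i) x)"
    if x: "x \<in> tor_cycles F i j" for x
  proof -
    have keys: "b \<in> basis F i" if "b \<in> keys x" for b
      using that x tor_cycles_subset[of F i j] by (auto simp: tensor_comp_def free_on_def)
    have comp: "tensor_lin (bdry F i) (tensor_lin (h i) x)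
        = tensor_lin (\<lambda>b. slin UNIV (bdry F i) (h i b)) x"
      by (rule tensor_lin_comp)
    show ?thesis
    proof (cases i)
      case 0
      show ?thesis
        unfolding comp by (rule tensor_lin_cong) (use keys h(2) 0 in auto)
    next
      case (Suc i')
      have "tensor_lin (\<lambda>b. slin UNIV (bdry F i) (h i b)) x
          = tensor_lin (\<lambda>b. \<theta> i b - slin W (h i') (bdry F i' b)) x"
        by (rule tensor_lin_cong) (use keys h(3) Suc in auto)
      also have "\<dots> = tensor_lin (\<theta> i) x - tensor_lin (h i') (tensor_lin (bdry F i') x)"
        by (simp add: tensor_lin_images_diff tensor_lin_comp[of _ _ _ W])
      also have "tensor_lin (bdry F i') x = 0"
        using x by (simp add: Suc tor_cycles_def tensor_map_eq)
      finally show ?thesis using comp by simp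
    qed
  qed
  note \<alpha>_chain = tensor_chain_map[where W = UNIV, OF \<alpha>(1) \<alpha>(3)]
  note \<beta>_chain = tensor_chain_map[where W = W, OF \<beta>(1) \<beta>(3)]
  obtain E where E: "finite E" "tensor_comp F i j \<subseteq> module.span fscale E"
    using tensor_comp_finite_dim[OF F] by blast
  obtain E' where E': "finite E'" "tensor_comp G i j \<subseteq> module.span fscale E'"
    using tensor_comp_finite_dim[OF G] by blast
  show ?thesis
    unfolding tor_dim_def
  proof (rule dim_quotient_le[OF linear_tensor_lin[of "\<beta> i"] _ E(1) _ E'(1)])
    show "tor_boundaries F i j \<subseteq> module.span fscale E"
      using tor_boundaries_subset_cycles[OF F] tor_cycles_subset E(2) by blast
    show "tor_cycles G i j \<subseteq> module.span fscale E'"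
      using tor_cycles_subset E'(2) by blast
    show "tor_boundaries G i j \<subseteq> tor_cycles G i j"
      by (rule tor_boundaries_subset_cycles[OF G])
    show "tensor_lin (\<beta> i) ` tor_boundaries G i j \<subseteq> tor_boundaries F i j"
    proof
      fix y assume "y \<in> tensor_lin (\<beta> i) ` tor_boundaries G i j"
      then obtain x where x: "x \<in> tensor_comp G (Suc i) j"
        "y = tensor_lin (\<beta> i) (tensor_lin (bdry G i) x)"
        by (auto simp: tor_boundaries_def tensor_map_eq)
      have "y = tensor_lin (bdry F i) (tensor_lin (\<beta> (Suc i)) x)"
        unfolding x(2) using \<beta>_chain(2)[OF _ _ x(1)] by simp
      then show "y \<in> tor_boundaries F i j"
        using \<beta>_chain(1)[OF _ _ x(1)] by (simp add: tor_boundaries_def tensor_map_eq)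
    qed
    fix x assume x: "x \<in> tor_cycles F i j"
    have xc: "x \<in> tensor_comp F i j" using x tor_cycles_subset by blast
    show "\<exists>v\<in>tor_cycles G i j. x - tensor_lin (\<beta> i) v \<in> tor_boundaries F i j"
    proof
      show "tensor_lin (\<alpha> i) x \<in> tor_cycles G i j"
      proof (cases i)
        case 0
        then show ?thesis using \<alpha>_chain(1)[OF _ _ xc] by (simp add: tor_cycles_def)
      next
        case (Suc i')
        have "tensor_lin (bdry F i') x = 0"
          using x by (simp add: Suc tor_cycles_def tensor_map_eq)
        then have "tensor_lin (bdry G i') (tensor_lin (\<alpha> i) x) = 0"
          using \<alpha>_chain(2)[of x i' j] xc Suc by simp
        then show ?thesis
          using \<alpha>_chain(1)[OF _ _ xc] Suc by (simp add: tor_cycles_def tensor_map_eq)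
      qed
      have "tensor_lin (\<theta> i) x = tensor_lin (\<beta> i) (tensor_lin (\<alpha> i) x) - x"
        unfolding \<theta>_def tensor_lin_images_diff tensor_lin_single_one
        by (simp add: tensor_lin_comp[of _ _ _ W])
      then have "x - tensor_lin (\<beta> i) (tensor_lin (\<alpha> i) x)
          = - tensor_lin (bdry F i) (tensor_lin (h i) x)"
        using bound[OF x] by simp
      also have "\<dots> = tensor_lin (bdry F i) (fscale (-1) (tensor_lin (h i) x))"
        unfolding tensor_lin_scale by simp
      finally have "x - tensor_lin (\<beta> i) (tensor_lin (\<alpha> i) x)
          = tensor_lin (bdry F i) (fscale (-1) (tensor_lin (h i) x))" .
      moreover have "tensor_lin (h i) x \<in> tensor_comp F (Suc i) j"
        using xc unfolding tensor_comp_def by (rule tensor_lin_degree) (rule h(1))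
      then have "fscale (-1) (tensor_lin (h i) x) \<in> tensor_comp F (Suc i) j"
        unfolding tensor_comp_def by (rule free.subspace_scale[OF subspace_free_on])
      ultimately show "x - tensor_lin (\<beta> i) (tensor_lin (\<alpha> i) x) \<in> tor_boundaries F i j"
        by (auto simp: tor_boundaries_def tensor_map_eq)
    qed
  qed
qed

text \<open>The resolutions in the definition of \<open>betti_quot\<close> are arbitrary, so the inequality goes through a
  third one, \<open>K\<close>, with entries in \<open>k[W]\<close>: \<open>tor_dim_retract\<close> is used with the identity of \<open>S/I\<close> to reach \<open>K\<close>
  and with the retraction to go on from there.\<close>

lemma betti_quot_retract:
  fixes A B :: "('v::finite, 'k::field) mpol set"
  assumes A: "\<And>a. a \<in> A \<Longrightarrow> kill_vars W a = a \<and> (\<exists>e. homogeneous e a)"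
    and B: "\<And>b. b \<in> B \<Longrightarrow> \<exists>e. homogeneous e b"
    and AB: "ideal_gen A \<subseteq> ideal_gen B" and BA: "kill_vars W ` ideal_gen B \<subseteq> ideal_gen A"
  shows "betti_quot (ideal_gen A) i j \<le> betti_quot (ideal_gen B) i j"
proof -
  let ?I = "ideal_gen A" and ?J = "ideal_gen B"
  have gr: "graded_ideal ?I" "graded_ideal ?J"
    by (rule graded_ideal_gen, use A B in blast)+
  obtain K where K: "graded_free_resolution ?I K"
    "\<And>i b. b \<in> basis K (Suc i) \<Longrightarrow> vars_in W (bdry K i b)"
    "\<And>b. b \<in> basis K 0 \<Longrightarrow> kill_vars W (augm K b) = augm K b"
    using resolution_exists[OF refl, of A W] A by metis
  obtain L where "graded_free_resolution ?J L"
    using resolution_exists[OF refl, of B UNIV] B by auto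
  then have G: "graded_free_resolution ?J (SOME F. graded_free_resolution ?J F)"
    by (rule someI)
  have F: "graded_free_resolution ?I (SOME F. graded_free_resolution ?I F)"
    using K(1) by (rule someI)
  have "betti_quot ?I i j \<le> tor_dim K i j"
    unfolding betti_quot_def
    by (rule tor_dim_retract[where W = UNIV, OF F K(1) gr(1) gr(1)]) (simp_all add: vars_in_def)
  also have "\<dots> \<le> betti_quot ?J i j"
    unfolding betti_quot_def
    by (rule tor_dim_retract[OF K(1) G gr AB BA K(2,3)])
  finally show ?thesis .
qed

theorem proposition4p2:
  fixes G H :: "'n::finite ugraph" and i j s :: nat
  assumes "simple_graph G" and "vertices G = UNIV"
    and "induced_subgraph H G"
    and "s \<ge> 1"
  shows "betti_quot (ideal_pow (lss_ideal H :: ('n \<times> 'd::finite, 'k::field) mpol set) s) i j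
       \<le> betti_quot (ideal_pow (lss_ideal G :: ('n \<times> 'd, 'k) mpol set) s) i j"
proof -
  let ?W = "vertices H \<times> (UNIV :: 'd set)"
  define gens where "gens K = {(\<Sum>l\<in>UNIV. pvar (i, l) * pvar (j, l)) :: ('n \<times> 'd, 'k) mpol
    | i j. {i, j} \<in> edges K}" for K :: "'n ugraph"
  have lss: "lss_ideal K = ideal_gen (gens K)" for K
    by (simp add: lss_ideal_def gens_def)
  have edges: "edges H = {e \<in> edges G. e \<subseteq> vertices H}"
    using assms(3) by (simp add: induced_subgraph_def)
  have hom: "\<exists>e. homogeneous e a" if "a \<in> gens K" for a K
    using that unfolding gens_def by (auto intro: exI homogeneous_lss_generator)
  have killH: "kill_vars ?W a = a" if "a \<in> gens H" for a
    using that by (auto simp: gens_def edges kill_vars_lss_generator)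
  have "gens H \<subseteq> gens G"
    by (auto simp: gens_def edges)
  then have HG: "lss_ideal H \<subseteq> (lss_ideal G :: ('n \<times> 'd, 'k) mpol set)"
    unfolding lss by (rule ideal_gen_mono)
  have "kill_vars ?W ` gens G \<subseteq> insert 0 (gens H)"
  proof (rule image_subsetI)
    fix a assume "a \<in> gens G"
    then obtain u v where uv: "a = (\<Sum>l\<in>UNIV. pvar (u, l) * pvar (v, l))" "{u, v} \<in> edges G"
      unfolding gens_def by blast
    show "kill_vars ?W a \<in> insert 0 (gens H)"
    proof (cases "u \<in> vertices H \<and> v \<in> vertices H")
      case True
      then have "a \<in> gens H" using uv unfolding gens_def edges by blast
      then show ?thesis by (simp add: killH)
    next
      case False
      then show ?thesis unfolding uv(1) kill_vars_lss_generator by auto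
    qed
  qed
  also have "\<dots> \<subseteq> ideal_gen (gens H)"
    using ideal_gen_base ideal.subspace_0[OF subspace_ideal_gen] by auto
  finally have GH: "kill_vars ?W ` (lss_ideal G :: ('n \<times> 'd, 'k) mpol set) \<subseteq> lss_ideal H"
    unfolding lss by (rule kill_vars_ideal_gen)
  obtain A where A: "ideal_pow (lss_ideal H) s = ideal_gen A"
    "\<And>a. a \<in> A \<Longrightarrow> kill_vars ?W a = a \<and> (\<exists>e. homogeneous e (a :: ('n \<times> 'd, 'k) mpol))"
    using ideal_pow_hom_generators[of "gens H" ?W s] hom killH unfolding lss by metis
  obtain B where B: "ideal_pow (lss_ideal G) s = ideal_gen B"
    "\<And>a. a \<in> B \<Longrightarrow> \<exists>e. homogeneous e (a :: ('n \<times> 'd, 'k) mpol)"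
    using ideal_pow_hom_generators[of "gens G" UNIV s] hom unfolding lss by (metis kill_vars_UNIV)
  show ?thesis
    unfolding A(1) B(1)
  proof (rule betti_quot_retract[OF A(2) B(2)])
    show "ideal_gen A \<subseteq> ideal_gen B"
      unfolding A(1)[symmetric] B(1)[symmetric] by (rule ideal_pow_mono[OF HG])
    show "kill_vars ?W ` ideal_gen B \<subseteq> ideal_gen A"
      unfolding A(1)[symmetric] B(1)[symmetric] by (rule kill_vars_ideal_pow[OF GH])
  qed
qed

end
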